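(* Let $\mathcal{T}$ be a triangulated category, and let $(1_X,g,h)$ be a map of triangles from $X\xrightarrow{u}Y\xrightarrow{v}Z\xrightarrow{w}\Sigma X$ to $X\xrightarrow{u'}Y'\xrightarrow{v'}Z'\xrightarrow{w'}\Sigma X$. Consider the candidate triangle $$(\ast)\qquad Y\xrightarrow{\begin{bmatrix} g \\ v \end{bmatrix}}Y'\oplus Z\xrightarrow{\begin{bmatrix}v'&-h\end{bmatrix}}Z'\xrightarrow{(\Sigma u)w'}\Sigma Y,$$ and call the commutative square with top $v\colon Y\to Z$, left $g\colon Y\to Y'$, right $h\colon Z\to Z'$, bottom $v'\colon Y'\to Z'$ the middle square. (1) The map $(1_X,g,h)$ is good if and only if the middle square is homotopy cartesian with differential $\partial=(\Sigma u)w'\colon Z'\to\Sigma Y$ (i.e. $(\ast)$ is exact). (2) The middle square is homotopy cartesian if and only if the candidate triangle $(\ast)$ is replaceably exact.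
   Context: $\mathcal{T}$ is a triangulated category with self-equivalence $\Sigma$. A candidate triangle is a diagram $X\xrightarrow{u}Y\xrightarrow{v}Z\xrightarrow{w}\Sigma X$ with $vu=0$, $wv=0$, $(\Sigma u)w=0$. "Exact triangle" or "triangle" means distinguished triangle. A map of triangles $(f,g,h)$ from $X\xrightarrow{u}Y\xrightarrow{v}Z\xrightarrow{w}\Sigma X$ to $X'\xrightarrow{u'}Y'\xrightarrow{v'}Z'\xrightarrow{w'}\Sigma X'$ (both exact) consists of $f\colon X\to X'$, $g\colon Y\to Y'$, $h\colon Z\to Z'$ with $gu=u'f$, $hv=v'g$, $(\Sigma f)w=w'h$. The mapping cone of $(f,g,h)$ is the sequence $X'\oplus Y\to Y'\oplus Z\to Z'\oplus\Sigma X\to\Sigma X'\oplus\Sigma Y$ with successive maps $\begin{bmatrix}u'&g \\ 0&-v\end{bmatrix},\begin{bmatrix}v'&h \\ 0&-w\end{bmatrix},\begin{bmatrix}w'&\Sigma f \\ 0&-\Sigma u\end{bmatrix}$ (acting on column vectors). $(f,g,h)$ is good if its mapping cone is an exact triangle. A commutative square with top map $p\colon P\to Q$, left map $a\colon P\to P'$, right map $b\colon Q\to Q'$ and bottom map $p'\colon P'\to Q'$ is homotopy cartesian if there is an exact triangle $P\xrightarrow{\begin{bmatrix} a \\ p \end{bmatrix}}P'\oplus Q\xrightarrow{\begin{bmatrix}p'&-b\end{bmatrix}}Q'\xrightarrow{\partial}\Sigma P$ for some map $\partial$, called the differential. In a candidate triangle $X\xrightarrow{u}Y\xrightarrow{v}Z\xrightarrow{w}\Sigma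 X$, the map $u$ is replaceable if there is a map $\hat u\colon X\to Y$ such that $X\xrightarrow{\hat u}Y\xrightarrow{v}Z\xrightarrow{w}\Sigma X$ is exact; replaceability of $v$ or of $w$ is defined similarly (replacing only that one map). The candidate triangle is replaceably exact if each of its three maps is replaceable. *)

theory Defs
  imports "HOL-Algebra.Group"
begin

section \<open>Categories, functors and equivalences\<close>

record ('o, 'm) category =
  Obj :: "'o set"
  Arr :: "'m set"
  Dom :: "'m \<Rightarrow> 'o"
  Cod :: "'m \<Rightarrow> 'o"
  Id :: "'o \<Rightarrow> 'm"
  Comp :: "'m \<Rightarrow> 'm \<Rightarrow> 'm" (infixr "\<cdot>\<index>" 70)

definition Hom :: "('o, 'm, 'r) category_scheme \<Rightarrow> 'o \<Rightarrow> 'o \<Rightarrow> 'm set" where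
  "Hom C X Y = {f \<in> Arr C. Dom C f = X \<and> Cod C f = Y}"

locale category =
  fixes C (structure)
  assumes dom_obj: "f \<in> Arr C \<Longrightarrow> Dom C f \<in> Obj C"
    and cod_obj: "f \<in> Arr C \<Longrightarrow> Cod C f \<in> Obj C"
    and id_hom: "X \<in> Obj C \<Longrightarrow> Id C X \<in> Hom C X X"
    and comp_hom: "f \<in> Hom C X Y \<Longrightarrow> g \<in> Hom C Y Z \<Longrightarrow> g \<cdot> f \<in> Hom C X Z"
    and comp_id: "f \<in> Hom C X Y \<Longrightarrow> f \<cdot> Id C X = f"
    and id_comp: "f \<in> Hom C X Y \<Longrightarrow> Id C Y \<cdot> f = f"
    and comp_assoc: "f \<in> Hom C W X \<Longrightarrow> g \<in> Hom C X Y \<Longrightarrow> h \<in> Hom C Y Z \<Longrightarrow>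
          (h \<cdot> g) \<cdot> f = h \<cdot> (g \<cdot> f)"

definition iso_arrow :: "('o, 'm, 'r) category_scheme \<Rightarrow> 'm \<Rightarrow> bool" where
  "iso_arrow C f \<longleftrightarrow> f \<in> Arr C \<and>
     (\<exists>g \<in> Hom C (Cod C f) (Dom C f).
        Comp C g f = Id C (Dom C f) \<and> Comp C f g = Id C (Cod C f))"

definition is_functor ::
  "('o, 'm, 'r) category_scheme \<Rightarrow> ('p, 'n, 's) category_scheme \<Rightarrow> ('o \<Rightarrow> 'p) \<Rightarrow> ('m \<Rightarrow> 'n) \<Rightarrow> bool"
  where
  "is_functor C D Fo Fa \<longleftrightarrow>
     (\<forall>X \<in> Obj C. Fo X \<in> Obj D \<and> Fa (Id C X) = Id D (Fo X)) \<and>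
     (\<forall>X Y. \<forall>f \<in> Hom C X Y. Fa f \<in> Hom D (Fo X) (Fo Y)) \<and>
     (\<forall>X Y Z. \<forall>f \<in> Hom C X Y. \<forall>g \<in> Hom C Y Z. Fa (Comp C g f) = Comp D (Fa g) (Fa f))"

definition natural_iso ::
  "('o, 'm, 'r) category_scheme \<Rightarrow> ('p, 'n, 's) category_scheme \<Rightarrow>
   ('o \<Rightarrow> 'p) \<Rightarrow> ('m \<Rightarrow> 'n) \<Rightarrow> ('o \<Rightarrow> 'p) \<Rightarrow> ('m \<Rightarrow> 'n) \<Rightarrow> ('o \<Rightarrow> 'n) \<Rightarrow> bool" where
  "natural_iso C D Fo Fa Go Ga \<eta> \<longleftrightarrow>
     (\<forall>X \<in> Obj C. \<eta> X \<in> Hom D (Fo X) (Go X) \<and> iso_arrow D (\<eta> X)) \<and>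
     (\<forall>X Y. \<forall>f \<in> Hom C X Y. Comp D (\<eta> Y) (Fa f) = Comp D (Ga f) (\<eta> X))"

definition is_equivalence ::
  "('o, 'm, 'r) category_scheme \<Rightarrow> ('p, 'n, 's) category_scheme \<Rightarrow> ('o \<Rightarrow> 'p) \<Rightarrow> ('m \<Rightarrow> 'n) \<Rightarrow> bool"
  where
  "is_equivalence C D Fo Fa \<longleftrightarrow> is_functor C D Fo Fa \<and>
     (\<exists>Go Ga \<eta> \<epsilon>. is_functor D C Go Ga \<and>
        natural_iso C C (\<lambda>X. X) (\<lambda>f. f) (\<lambda>X. Go (Fo X)) (\<lambda>f. Ga (Fa f)) \<eta> \<and>
        natural_iso D D (\<lambda>X. Fo (Go X)) (\<lambda>f. Fa (Ga f)) (\<lambda>X. X) (\<lambda>f. f) \<epsilon>)"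


section \<open>Additive categories\<close>

text \<open>The binary direct sums (objects, injections, projections) are part of the structure,
  because the matrix notation refers to a fixed choice of them; the axioms do not restrict
  this choice.\<close>

record ('o, 'm) additive_category = "('o, 'm) category" +
  Add :: "'m \<Rightarrow> 'm \<Rightarrow> 'm" (infixl "\<boxplus>\<index>" 65)
  Zero :: "'o \<Rightarrow> 'o \<Rightarrow> 'm"
  Dsum :: "'o \<Rightarrow> 'o \<Rightarrow> 'o"
  Inj1 :: "'o \<Rightarrow> 'o \<Rightarrow> 'm"
  Inj2 :: "'o \<Rightarrow> 'o \<Rightarrow> 'm"
  Proj1 :: "'o \<Rightarrow> 'o \<Rightarrow> 'm"
  Proj2 :: "'o \<Rightarrow> 'o \<Rightarrow> 'm"

definition Hom_group :: "('o, 'm, 'r) additive_category_scheme \<Rightarrow> 'o \<Rightarrow> 'o \<Rightarrow> 'm monoid" where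
  "Hom_group A X Y = \<lparr>carrier = Hom A X Y, mult = Add A, one = Zero A X Y\<rparr>"

definition Neg :: "('o, 'm, 'r) additive_category_scheme \<Rightarrow> 'm \<Rightarrow> 'm" where
  "Neg A f = inv\<^bsub>Hom_group A (Dom A f) (Cod A f)\<^esub> f"

definition zero_object :: "('o, 'm, 'r) category_scheme \<Rightarrow> 'o \<Rightarrow> bool" where
  "zero_object C O' \<longleftrightarrow> O' \<in> Obj C \<and>
     (\<forall>X \<in> Obj C. (\<exists>!f. f \<in> Hom C O' X) \<and> (\<exists>!f. f \<in> Hom C X O'))"

locale additive_category = category A for A (structure) +
  assumes hom_group: "X \<in> Obj A \<Longrightarrow> Y \<in> Obj A \<Longrightarrow> comm_group (Hom_group A X Y)"
    and comp_add: "f \<in> Hom A X Y \<Longrightarrow> f' \<in> Hom A X Y \<Longrightarrow> g \<in> Hom A Y Z \<Longrightarrow>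
          g \<cdot> (f \<boxplus> f') = g \<cdot> f \<boxplus> g \<cdot> f'"
    and add_comp: "f \<in> Hom A X Y \<Longrightarrow> g \<in> Hom A Y Z \<Longrightarrow> g' \<in> Hom A Y Z \<Longrightarrow>
          (g \<boxplus> g') \<cdot> f = g \<cdot> f \<boxplus> g' \<cdot> f"
    and ex_zero_object: "\<exists>O'. zero_object A O'"
    and dsum_obj: "X \<in> Obj A \<Longrightarrow> Y \<in> Obj A \<Longrightarrow> Dsum A X Y \<in> Obj A"
    and inj1_hom: "X \<in> Obj A \<Longrightarrow> Y \<in> Obj A \<Longrightarrow> Inj1 A X Y \<in> Hom A X (Dsum A X Y)"
    and inj2_hom: "X \<in> Obj A \<Longrightarrow> Y \<in> Obj A \<Longrightarrow> Inj2 A X Y \<in> Hom A Y (Dsum A X Y)"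
    and proj1_hom: "X \<in> Obj A \<Longrightarrow> Y \<in> Obj A \<Longrightarrow> Proj1 A X Y \<in> Hom A (Dsum A X Y) X"
    and proj2_hom: "X \<in> Obj A \<Longrightarrow> Y \<in> Obj A \<Longrightarrow> Proj2 A X Y \<in> Hom A (Dsum A X Y) Y"
    and proj1_inj1: "X \<in> Obj A \<Longrightarrow> Y \<in> Obj A \<Longrightarrow> Proj1 A X Y \<cdot> Inj1 A X Y = Id A X"
    and proj2_inj2: "X \<in> Obj A \<Longrightarrow> Y \<in> Obj A \<Longrightarrow> Proj2 A X Y \<cdot> Inj2 A X Y = Id A Y"
    and proj1_inj2: "X \<in> Obj A \<Longrightarrow> Y \<in> Obj A \<Longrightarrow> Proj1 A X Y \<cdot> Inj2 A X Y = Zero A Y X"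
    and proj2_inj1: "X \<in> Obj A \<Longrightarrow> Y \<in> Obj A \<Longrightarrow> Proj2 A X Y \<cdot> Inj1 A X Y = Zero A X Y"
    and inj_proj: "X \<in> Obj A \<Longrightarrow> Y \<in> Obj A \<Longrightarrow>
          Inj1 A X Y \<cdot> Proj1 A X Y \<boxplus> Inj2 A X Y \<cdot> Proj2 A X Y = Id A (Dsum A X Y)"

text \<open>Matrices act on column vectors: \<open>Col f g : P \<rightarrow> R \<oplus> S\<close> for \<open>f : P \<rightarrow> R\<close>, \<open>g : P \<rightarrow> S\<close>;
  \<open>Row f g : P \<oplus> Q \<rightarrow> R\<close> for \<open>f : P \<rightarrow> R\<close>, \<open>g : Q \<rightarrow> R\<close>; and \<open>Mat a b c d : P \<oplus> Q \<rightarrow> R \<oplus> S\<close> has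
  first row \<open>a : P \<rightarrow> R\<close>, \<open>b : Q \<rightarrow> R\<close> and second row \<open>c : P \<rightarrow> S\<close>, \<open>d : Q \<rightarrow> S\<close>.\<close>

definition Col :: "('o, 'm, 'r) additive_category_scheme \<Rightarrow> 'm \<Rightarrow> 'm \<Rightarrow> 'm" where
  "Col A f g = Add A (Comp A (Inj1 A (Cod A f) (Cod A g)) f) (Comp A (Inj2 A (Cod A f) (Cod A g)) g)"

definition Row :: "('o, 'm, 'r) additive_category_scheme \<Rightarrow> 'm \<Rightarrow> 'm \<Rightarrow> 'm" where
  "Row A f g = Add A (Comp A f (Proj1 A (Dom A f) (Dom A g))) (Comp A g (Proj2 A (Dom A f) (Dom A g)))"

definition Mat :: "('o, 'm, 'r) additive_category_scheme \<Rightarrow> 'm \<Rightarrow> 'm \<Rightarrow> 'm \<Rightarrow> 'm \<Rightarrow> 'm" where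
  "Mat A a b c d = Row A (Col A a c) (Col A b d)"


section \<open>Triangulated categories\<close>

text \<open>A diagram \<open>X \<rightarrow> Y \<rightarrow> Z \<rightarrow> \<Sigma>X\<close> is given by its three arrows; \<open>SuspO\<close> and \<open>SuspA\<close> are the
  object and arrow parts of \<open>\<Sigma>\<close>, and \<open>Exact\<close> is the class of distinguished triangles.\<close>

record ('o, 'm) triangulated_category = "('o, 'm) additive_category" +
  SuspO :: "'o \<Rightarrow> 'o"
  SuspA :: "'m \<Rightarrow> 'm"
  Exact :: "'m \<Rightarrow> 'm \<Rightarrow> 'm \<Rightarrow> bool"

definition diagram ::
  "('o, 'm, 'r) triangulated_category_scheme \<Rightarrow> 'm \<Rightarrow> 'm \<Rightarrow> 'm \<Rightarrow> bool" where
  "diagram T u v w \<longleftrightarrow>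
     (\<exists>X Y Z. u \<in> Hom T X Y \<and> v \<in> Hom T Y Z \<and> w \<in> Hom T Z (SuspO T X))"

definition candidate_triangle ::
  "('o, 'm, 'r) triangulated_category_scheme \<Rightarrow> 'm \<Rightarrow> 'm \<Rightarrow> 'm \<Rightarrow> bool" where
  "candidate_triangle T u v w \<longleftrightarrow> diagram T u v w \<and>
     Comp T v u = Zero T (Dom T u) (Cod T v) \<and>
     Comp T w v = Zero T (Dom T v) (Cod T w) \<and>
     Comp T (SuspA T u) w = Zero T (Dom T w) (SuspO T (Cod T u))"

definition diagram_map ::
  "('o, 'm, 'r) triangulated_category_scheme \<Rightarrow> 'm \<Rightarrow> 'm \<Rightarrow> 'm \<Rightarrow> 'm \<Rightarrow> 'm \<Rightarrow> 'm \<Rightarrow>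
   'm \<Rightarrow> 'm \<Rightarrow> 'm \<Rightarrow> bool" where
  "diagram_map T u v w u' v' w' f g h \<longleftrightarrow>
     f \<in> Hom T (Dom T u) (Dom T u') \<and>
     g \<in> Hom T (Dom T v) (Dom T v') \<and>
     h \<in> Hom T (Dom T w) (Dom T w') \<and>
     Comp T g u = Comp T u' f \<and>
     Comp T h v = Comp T v' g \<and>
     Comp T (SuspA T f) w = Comp T w' h"

locale triangulated_category = additive_category T for T (structure) +
  assumes susp_equivalence: "is_equivalence T T (SuspO T) (SuspA T)"
    and susp_add: "f \<in> Hom T X Y \<Longrightarrow> g \<in> Hom T X Y \<Longrightarrow>
          SuspA T (f \<boxplus> g) = SuspA T f \<boxplus> SuspA T g"
    and exact_candidate: "Exact T u v w \<Longrightarrow> candidate_triangle T u v w"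
    and exact_iso: "Exact T u v w \<Longrightarrow> candidate_triangle T u' v' w' \<Longrightarrow>
          diagram_map T u v w u' v' w' f g h \<Longrightarrow>
          iso_arrow T f \<Longrightarrow> iso_arrow T g \<Longrightarrow> iso_arrow T h \<Longrightarrow> Exact T u' v' w'"
    and exact_id: "X \<in> Obj T \<Longrightarrow> zero_object T O' \<Longrightarrow>
          Exact T (Id T X) (Zero T X O') (Zero T O' (SuspO T X))"
    and exact_ex: "u \<in> Hom T X Y \<Longrightarrow> \<exists>v w. Exact T u v w"
    and exact_rotate: "diagram T u v w \<Longrightarrow>
          Exact T u v w \<longleftrightarrow> Exact T v w (Neg T (SuspA T u))"
    and exact_fill: "Exact T u v w \<Longrightarrow> Exact T u' v' w' \<Longrightarrow>
          f \<in> Hom T (Dom T u) (Dom T u') \<Longrightarrow> g \<in> Hom T (Dom T v) (Dom T v') \<Longrightarrow>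
          g \<cdot> u = u' \<cdot> f \<Longrightarrow> \<exists>h. diagram_map T u v w u' v' w' f g h"
    and octahedral: "Exact T u j d \<Longrightarrow> Exact T v k i \<Longrightarrow> Cod T u = Dom T v \<Longrightarrow>
          Exact T (v \<cdot> u) l m \<Longrightarrow>
          \<exists>f g. Exact T f g (SuspA T j \<cdot> i) \<and>
            f \<cdot> j = l \<cdot> v \<and> m \<cdot> f = d \<and> g \<cdot> l = k \<and> i \<cdot> g = SuspA T u \<cdot> m"


section \<open>Good maps, homotopy cartesian squares, replaceable maps\<close>

definition triangle_map ::
  "('o, 'm, 'r) triangulated_category_scheme \<Rightarrow> 'm \<Rightarrow> 'm \<Rightarrow> 'm \<Rightarrow> 'm \<Rightarrow> 'm \<Rightarrow> 'm \<Rightarrow>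
   'm \<Rightarrow> 'm \<Rightarrow> 'm \<Rightarrow> bool" where
  "triangle_map T u v w u' v' w' f g h \<longleftrightarrow>
     Exact T u v w \<and> Exact T u' v' w' \<and> diagram_map T u v w u' v' w' f g h"

text \<open>The canonical isomorphism \<open>\<Sigma>X \<oplus> \<Sigma>Y \<rightarrow> \<Sigma>(X \<oplus> Y)\<close>.  It is needed to regard the mapping cone,
  which ends in \<open>\<Sigma>X' \<oplus> \<Sigma>Y\<close>, as a diagram ending in \<open>\<Sigma>(X' \<oplus> Y)\<close>.\<close>

definition susp_dsum :: "('o, 'm, 'r) triangulated_category_scheme \<Rightarrow> 'o \<Rightarrow> 'o \<Rightarrow> 'm" where
  "susp_dsum T X Y = Row T (SuspA T (Inj1 T X Y)) (SuspA T (Inj2 T X Y))"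

definition good ::
  "('o, 'm, 'r) triangulated_category_scheme \<Rightarrow> 'm \<Rightarrow> 'm \<Rightarrow> 'm \<Rightarrow> 'm \<Rightarrow> 'm \<Rightarrow> 'm \<Rightarrow>
   'm \<Rightarrow> 'm \<Rightarrow> 'm \<Rightarrow> bool" where
  "good T u v w u' v' w' f g h \<longleftrightarrow>
     triangle_map T u v w u' v' w' f g h \<and>
     Exact T
       (Mat T u' g (Zero T (Dom T u') (Cod T v)) (Neg T v))
       (Mat T v' h (Zero T (Dom T v') (Cod T w)) (Neg T w))
       (Comp T (susp_dsum T (Dom T u') (Dom T v))
         (Mat T w' (SuspA T f) (Zero T (Dom T w') (SuspO T (Cod T u))) (Neg T (SuspA T u))))"

text \<open>In the next two definitions the square has top \<open>p : P \<rightarrow> Q\<close>, left \<open>a : P \<rightarrow> P'\<close>,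
  right \<open>b : Q \<rightarrow> Q'\<close> and bottom \<open>p' : P' \<rightarrow> Q'\<close>.\<close>

definition homotopy_cartesian_with ::
  "('o, 'm, 'r) triangulated_category_scheme \<Rightarrow> 'm \<Rightarrow> 'm \<Rightarrow> 'm \<Rightarrow> 'm \<Rightarrow> 'm \<Rightarrow> bool" where
  "homotopy_cartesian_with T p a b p' d \<longleftrightarrow>
     (\<exists>P Q P' Q'. p \<in> Hom T P Q \<and> a \<in> Hom T P P' \<and> b \<in> Hom T Q Q' \<and> p' \<in> Hom T P' Q' \<and>
        d \<in> Hom T Q' (SuspO T P)) \<and>
     Comp T b p = Comp T p' a \<and>
     Exact T (Col T a p) (Row T p' (Neg T b)) d"

definition homotopy_cartesian ::
  "('o, 'm, 'r) triangulated_category_scheme \<Rightarrow> 'm \<Rightarrow> 'm \<Rightarrow> 'm \<Rightarrow> 'm \<Rightarrow> bool" where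
  "homotopy_cartesian T p a b p' \<longleftrightarrow> (\<exists>d. homotopy_cartesian_with T p a b p' d)"

definition replaceably_exact ::
  "('o, 'm, 'r) triangulated_category_scheme \<Rightarrow> 'm \<Rightarrow> 'm \<Rightarrow> 'm \<Rightarrow> bool" where
  "replaceably_exact T u v w \<longleftrightarrow> candidate_triangle T u v w \<and>
     (\<exists>u1 \<in> Hom T (Dom T u) (Cod T u). Exact T u1 v w) \<and>
     (\<exists>v1 \<in> Hom T (Dom T v) (Cod T v). Exact T u v1 w) \<and>
     (\<exists>w1 \<in> Hom T (Dom T w) (Cod T w). Exact T u v w1)"

end

theory Submission
  imports Defs
begin

text \<open>The cone of \<open>(1, g, h)\<close> is the direct sum of \<open>(\<ast>)\<close> and a contractible triangle on \<open>X\<close>: up to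
  the sign \<open>diag(1, -1)\<close> on \<open>Y' \<oplus> Z\<close> the inclusion is \<open>(0, 1)\<close>, \<open>(1, -w')\<close> and the projection is
  \<open>(u, 1)\<close>, \<open>(1, 0)\<close>.  A diagram through which weak kernels pass, and which receives a comparison map
  from an exact triangle on the same first arrow, is exact; this gives both directions of (1).

  For (2), the first two maps of \<open>(\<ast>)\<close> are always replaceable, so that only the third matters.  The
  octahedral axiom applied to \<open>Y \<rightarrow> Y' \<oplus> Z \<rightarrow> Z\<close>, with composite \<open>v\<close>, shows that the cone of the first
  map \<open>(g, v)\<close> sits in a triangle on \<open>u'\<close> and hence is \<open>Z'\<close>, with the prescribed differential.
  Applied to \<open>Y' \<rightarrow> Y' \<oplus> Z \<rightarrow> Z'\<close>, with composite \<open>v'\<close>, it likewise shows that the cone of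
  \<open>(v', -h)\<close> is \<open>\<Sigma>Y\<close>.\<close>

section \<open>Categories and equivalences\<close>

text \<open>As a simp rule this splits every typing statement into arrow, domain and codomain, so
  that the types of composites are computed by rewriting.\<close>

lemma Hom_iff [simp]: "f \<in> Hom C X Y \<longleftrightarrow> f \<in> Arr C \<and> Dom C f = X \<and> Cod C f = Y"
  by (auto simp: Hom_def)

context category
begin

lemma Dom_obj [simp]: "f \<in> Arr C \<Longrightarrow> Dom C f \<in> Obj C"
  by (rule dom_obj)

lemma Cod_obj [simp]: "f \<in> Arr C \<Longrightarrow> Cod C f \<in> Obj C"
  by (rule cod_obj)

lemma Id_arrow [simp]:
  assumes "X \<in> Obj C"
  shows "Id C X \<in> Arr C" "Dom C (Id C X) = X" "Cod C (Id C X) = X"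
  using id_hom[OF assms] by auto

lemma Comp_arrow [simp]:
  assumes "f \<in> Arr C" "g \<in> Arr C" "Cod C f = Dom C g"
  shows "g \<cdot> f \<in> Arr C" "Dom C (g \<cdot> f) = Dom C f" "Cod C (g \<cdot> f) = Cod C g"
  using comp_hom[of f "Dom C f" "Cod C f" g "Cod C g"] assms by auto

lemma Comp_Id [simp]: "f \<in> Arr C \<Longrightarrow> Dom C f = X \<Longrightarrow> f \<cdot> Id C X = f"
  using comp_id[of f X "Cod C f"] by simp

lemma Id_Comp [simp]: "f \<in> Arr C \<Longrightarrow> Cod C f = X \<Longrightarrow> Id C X \<cdot> f = f"
  using id_comp[of f "Dom C f" X] by simp

lemma Comp_assoc:
  assumes "f \<in> Arr C" "g \<in> Arr C" "h \<in> Arr C" "Cod C f = Dom C g" "Cod C g = Dom C h"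
  shows "(h \<cdot> g) \<cdot> f = h \<cdot> (g \<cdot> f)"
  using comp_assoc[of f "Dom C f" "Cod C f" g "Cod C g" h "Cod C h"] assms by simp

text \<open>Composites are rewritten by \<open>Comp_assoc\<close> with brackets to the right, where
  \<open>g \<cdot> f\<close> is no longer a subterm of \<open>g \<cdot> (f \<cdot> t)\<close>; this
  is how an equation for \<open>g \<cdot> f\<close> is applied there.\<close>

lemma Comp_eq_Comp:
  assumes "g \<cdot> f = k" "f \<in> Arr C" "g \<in> Arr C" "t \<in> Arr C" "Cod C f = Dom C g" "Cod C t = Dom C f"
  shows "g \<cdot> (f \<cdot> t) = k \<cdot> t"
  using Comp_assoc[of t f g] assms by simp

lemma iso_arrowI:
  assumes "f \<in> Arr C" "g \<in> Arr C" "Dom C g = Cod C f" "Cod C g = Dom C f"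
    and "g \<cdot> f = Id C (Dom C f)" "f \<cdot> g = Id C (Cod C f)"
  shows "iso_arrow C f"
  using assms unfolding iso_arrow_def by auto

lemma iso_arrowE:
  assumes "iso_arrow C f"
  obtains g where "f \<in> Arr C" "g \<in> Arr C" "Dom C g = Cod C f" "Cod C g = Dom C f"
    "g \<cdot> f = Id C (Dom C f)" "f \<cdot> g = Id C (Cod C f)"
  using assms unfolding iso_arrow_def by auto

lemma iso_Id [simp]: "X \<in> Obj C \<Longrightarrow> iso_arrow C (Id C X)"
  by (rule iso_arrowI[where g = "Id C X"]) auto

lemma iso_cancel_left:
  assumes "iso_arrow C e" "f \<in> Arr C" "f' \<in> Arr C" "Cod C f = Dom C e" "Cod C f' = Dom C e"
    and "e \<cdot> f = e \<cdot> f'"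
  shows "f = f'"
proof -
  obtain g where g: "e \<in> Arr C" "g \<in> Arr C" "Dom C g = Cod C e" "Cod C g = Dom C e"
    "g \<cdot> e = Id C (Dom C e)" using assms(1) by (rule iso_arrowE)
  have "f = g \<cdot> (e \<cdot> f)" using g assms(2,4) by (simp add: Comp_eq_Comp[OF g(5)])
  also have "\<dots> = g \<cdot> (e \<cdot> f')" using assms(6) by simp
  also have "\<dots> = f'" using g assms(3,5) by (simp add: Comp_eq_Comp[OF g(5)])
  finally show ?thesis .
qed

lemma iso_cancel_right:
  assumes "iso_arrow C e" "f \<in> Arr C" "f' \<in> Arr C" "Dom C f = Cod C e" "Dom C f' = Cod C e"
    and "f \<cdot> e = f' \<cdot> e"
  shows "f = f'"
proof -
  obtain g where g: "e \<in> Arr C" "g \<in> Arr C" "Dom C g = Cod C e" "Cod C g = Dom C e"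
    "e \<cdot> g = Id C (Cod C e)" using assms(1) by (rule iso_arrowE)
  have "f = (f \<cdot> e) \<cdot> g" using g assms(2,4) by (simp add: Comp_assoc)
  also have "\<dots> = (f' \<cdot> e) \<cdot> g" using assms(6) by simp
  also have "\<dots> = f'" using g assms(3,5) by (simp add: Comp_assoc)
  finally show ?thesis .
qed

end

text \<open>Naturality of the unit gives
  \<open>\<eta> Y \<cdot> f = Ga (Fa f) \<cdot> \<eta> X\<close>, whose right side depends on
  \<open>f\<close> only through \<open>Fa f\<close>; the isomorphism \<open>\<eta> Y\<close> can be
  cancelled.\<close>

lemma equivalence_faithful:
  assumes C: "category C" and E: "is_equivalence C D Fo Fa"
    and f: "f \<in> Hom C X Y" "f' \<in> Hom C X Y" "Fa f = Fa f'"
  shows "f = f'"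
proof -
  interpret C: category C by (rule C)
  obtain Go Ga \<eta> where \<eta>: "natural_iso C C (\<lambda>X. X) (\<lambda>f. f) (\<lambda>X. Go (Fo X)) (\<lambda>f. Ga (Fa f)) \<eta>"
    using E unfolding is_equivalence_def by blast
  have Y: "Y \<in> Obj C" using f C.cod_obj by fastforce
  have "Comp C (\<eta> Y) f = Comp C (\<eta> Y) f'"
    using \<eta> f unfolding natural_iso_def by metis
  moreover have "iso_arrow C (\<eta> Y)" "\<eta> Y \<in> Hom C Y (Go (Fo Y))"
    using \<eta> Y unfolding natural_iso_def by blast+
  ultimately show ?thesis using C.iso_cancel_left[of "\<eta> Y" f f'] f by simp
qed

text \<open>The preimage is \<open>Ga t\<close> conjugated by the unit, with \<open>k\<close>
  inverse to \<open>\<eta> Y\<close>. Naturality of the unit gives \<open>Ga (Fa f) = Ga t\<close>,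
  and naturality of the counit for both \<open>Fa f\<close> and \<open>t\<close> then identifies
  these two.\<close>

lemma equivalence_full:
  assumes C: "category C" and D: "category D" and E: "is_equivalence C D Fo Fa"
    and X: "X \<in> Obj C" and Y: "Y \<in> Obj C" and t: "t \<in> Hom D (Fo X) (Fo Y)"
  shows "\<exists>f \<in> Hom C X Y. Fa f = t"
proof -
  interpret C: category C by (rule C)
  interpret D: category D by (rule D)
  obtain Go Ga \<eta> \<epsilon> where F: "is_functor C D Fo Fa" and G: "is_functor D C Go Ga"
    and \<eta>: "natural_iso C C (\<lambda>X. X) (\<lambda>f. f) (\<lambda>X. Go (Fo X)) (\<lambda>f. Ga (Fa f)) \<eta>"
    and \<epsilon>: "natural_iso D D (\<lambda>X. Fo (Go X)) (\<lambda>f. Fa (Ga f)) (\<lambda>X. X) (\<lambda>f. f) \<epsilon>"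
    using E unfolding is_equivalence_def by blast
  have isoX: "iso_arrow C (\<eta> X)" "\<eta> X \<in> Hom C X (Go (Fo X))"
    and isoY: "iso_arrow C (\<eta> Y)" "\<eta> Y \<in> Hom C Y (Go (Fo Y))"
    using \<eta> X Y unfolding natural_iso_def by blast+
  obtain k where k: "k \<in> Arr C" "Dom C k = Go (Fo Y)" "Cod C k = Y"
    "Comp C (\<eta> Y) k = Id C (Go (Fo Y))"
    using isoY(1) isoY(2) by (elim C.iso_arrowE) auto
  have Gt: "Ga t \<in> Hom C (Go (Fo X)) (Go (Fo Y))"
    using G t unfolding is_functor_def by blast
  define f where "f = Comp C k (Comp C (Ga t) (\<eta> X))"
  have f: "f \<in> Hom C X Y" using k Gt isoX unfolding f_def by simp
  have Ff: "Fa f \<in> Hom D (Fo X) (Fo Y)" using F f unfolding is_functor_def by blast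
  have GFf: "Ga (Fa f) \<in> Hom C (Go (Fo X)) (Go (Fo Y))"
    using G Ff unfolding is_functor_def by blast
  have "Comp C (Ga (Fa f)) (\<eta> X) = Comp C (\<eta> Y) f"
    using \<eta> f unfolding natural_iso_def by metis
  also have "\<dots> = Comp C (Ga t) (\<eta> X)"
    unfolding f_def using k Gt isoX isoY by (simp add: C.Comp_eq_Comp[OF k(4)])
  finally have eq: "Ga (Fa f) = Ga t"
    using C.iso_cancel_right[OF isoX(1)] GFf Gt isoX(2) by simp
  have "Comp D (Fa f) (\<epsilon> (Fo X)) = Comp D (\<epsilon> (Fo Y)) (Fa (Ga (Fa f)))"
    using \<epsilon> Ff unfolding natural_iso_def by metis
  also have "\<dots> = Comp D t (\<epsilon> (Fo X))"
    using \<epsilon> t eq unfolding natural_iso_def by metis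
  finally have "Comp D (Fa f) (\<epsilon> (Fo X)) = Comp D t (\<epsilon> (Fo X))" .
  moreover have "Fo X \<in> Obj D" using F X unfolding is_functor_def by blast
  then have "iso_arrow D (\<epsilon> (Fo X))" "\<epsilon> (Fo X) \<in> Hom D (Fo (Go (Fo X))) (Fo X)"
    using \<epsilon> unfolding natural_iso_def by blast+
  ultimately have "Fa f = t"
    using D.iso_cancel_right[of "\<epsilon> (Fo X)" "Fa f" t] Ff t by simp
  with f show ?thesis by blast
qed

section \<open>Additive categories\<close>

context additive_category
begin

section \<open>Zero arrows, sums and signs in the Hom groups\<close>

lemma Zero_arrow [simp]:
  assumes "X \<in> Obj A" "Y \<in> Obj A"
  shows "Zero A X Y \<in> Arr A" "Dom A (Zero A X Y) = X" "Cod A (Zero A X Y) = Y"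
proof -
  interpret G: comm_group "Hom_group A X Y" using hom_group assms by blast
  show "Zero A X Y \<in> Arr A" "Dom A (Zero A X Y) = X" "Cod A (Zero A X Y) = Y"
    using G.one_closed by (simp_all add: Hom_group_def)
qed

lemma Add_arrow [simp]:
  assumes "f \<in> Arr A" "g \<in> Arr A" "Dom A f = Dom A g" "Cod A f = Cod A g"
  shows "f \<boxplus> g \<in> Arr A" "Dom A (f \<boxplus> g) = Dom A g" "Cod A (f \<boxplus> g) = Cod A g"
proof -
  interpret G: comm_group "Hom_group A (Dom A g) (Cod A g)" using hom_group assms by auto
  show "f \<boxplus> g \<in> Arr A" "Dom A (f \<boxplus> g) = Dom A g" "Cod A (f \<boxplus> g) = Cod A g"
    using G.m_closed[of f g] assms by (simp_all add: Hom_group_def)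
qed

lemma Add_comm:
  assumes "f \<in> Arr A" "g \<in> Arr A" "Dom A f = Dom A g" "Cod A f = Cod A g"
  shows "f \<boxplus> g = g \<boxplus> f"
proof -
  interpret G: comm_group "Hom_group A (Dom A g) (Cod A g)" using hom_group assms by auto
  show ?thesis using G.m_comm[of f g] assms by (simp add: Hom_group_def)
qed

lemma Add_assoc:
  assumes "f \<in> Arr A" "g \<in> Arr A" "k \<in> Arr A" "Dom A f = Dom A g" "Cod A f = Cod A g"
    "Dom A g = Dom A k" "Cod A g = Cod A k"
  shows "(f \<boxplus> g) \<boxplus> k = f \<boxplus> (g \<boxplus> k)"
proof -
  interpret G: comm_group "Hom_group A (Dom A g) (Cod A g)" using hom_group assms by auto
  show ?thesis using G.m_assoc[of f g k] assms by (simp add: Hom_group_def)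
qed

lemma Add_left_comm:
  assumes "f \<in> Arr A" "g \<in> Arr A" "k \<in> Arr A" "Dom A f = Dom A g" "Cod A f = Cod A g"
    "Dom A g = Dom A k" "Cod A g = Cod A k"
  shows "f \<boxplus> (g \<boxplus> k) = g \<boxplus> (f \<boxplus> k)"
  using Add_assoc[of f g k] Add_assoc[of g f k] Add_comm[of f g] assms by simp

lemmas Add_ac = Add_comm Add_assoc Add_left_comm

lemma Zero_Add [simp]:
  assumes "f \<in> Arr A" "Dom A f = X" "Cod A f = Y"
  shows "Zero A X Y \<boxplus> f = f" "f \<boxplus> Zero A X Y = f"
proof -
  interpret G: comm_group "Hom_group A X Y" using hom_group assms by auto
  show "Zero A X Y \<boxplus> f = f" "f \<boxplus> Zero A X Y = f"
    using G.l_one[of f] G.r_one[of f] assms by (simp_all add: Hom_group_def)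
qed

lemma Neg_arrow [simp]:
  assumes "f \<in> Arr A"
  shows "Neg A f \<in> Arr A" "Dom A (Neg A f) = Dom A f" "Cod A (Neg A f) = Cod A f"
proof -
  interpret G: comm_group "Hom_group A (Dom A f) (Cod A f)" using hom_group assms by auto
  have "Neg A f \<in> carrier (Hom_group A (Dom A f) (Cod A f))"
    unfolding Neg_def using assms by (intro G.inv_closed) (simp add: Hom_group_def)
  then show "Neg A f \<in> Arr A" "Dom A (Neg A f) = Dom A f" "Cod A (Neg A f) = Cod A f"
    by (simp_all add: Hom_group_def)
qed

lemma Add_Neg [simp]:
  assumes "f \<in> Arr A"
  shows "f \<boxplus> Neg A f = Zero A (Dom A f) (Cod A f)" "Neg A f \<boxplus> f = Zero A (Dom A f) (Cod A f)"
proof -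
  interpret G: comm_group "Hom_group A (Dom A f) (Cod A f)" using hom_group assms by auto
  show "f \<boxplus> Neg A f = Zero A (Dom A f) (Cod A f)" "Neg A f \<boxplus> f = Zero A (Dom A f) (Cod A f)"
    using G.r_inv[of f] G.l_inv[of f] assms by (simp_all add: Hom_group_def Neg_def)
qed

lemma Add_Neg_cancel [simp]:
  assumes "f \<in> Arr A" "g \<in> Arr A" "Dom A f = Dom A g" "Cod A f = Cod A g"
  shows "f \<boxplus> (Neg A f \<boxplus> g) = g" "Neg A f \<boxplus> (f \<boxplus> g) = g"
  using Add_assoc[of f "Neg A f" g] Add_assoc[of "Neg A f" f g] assms by simp_all

lemma Neg_unique:
  assumes "f \<in> Arr A" "g \<in> Arr A" "Dom A f = Dom A g" "Cod A f = Cod A g"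
    and "f \<boxplus> g = Zero A (Dom A g) (Cod A g)"
  shows "g = Neg A f"
  using Add_Neg_cancel(2)[of f g] assms by simp

lemma Neg_Neg [simp]: "f \<in> Arr A \<Longrightarrow> Neg A (Neg A f) = f"
  using Neg_unique[of "Neg A f" f] by simp

lemma Neg_Zero [simp]: "X \<in> Obj A \<Longrightarrow> Y \<in> Obj A \<Longrightarrow> Neg A (Zero A X Y) = Zero A X Y"
  using Neg_unique[of "Zero A X Y" "Zero A X Y"] by simp

lemma Neg_Add [simp]:
  assumes "f \<in> Arr A" "g \<in> Arr A" "Dom A f = Dom A g" "Cod A f = Cod A g"
  shows "Neg A (f \<boxplus> g) = Neg A f \<boxplus> Neg A g"
proof -
  have "(f \<boxplus> g) \<boxplus> (Neg A f \<boxplus> Neg A g) = f \<boxplus> (Neg A f \<boxplus> (g \<boxplus> Neg A g))"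
    using assms by (simp add: Add_assoc Add_left_comm[of g "Neg A f"] del: Add_Neg Add_Neg_cancel)
  also have "\<dots> = Zero A (Dom A f) (Cod A f)"
    using assms by simp
  finally show ?thesis using Neg_unique[of "f \<boxplus> g" "Neg A f \<boxplus> Neg A g"] assms by simp
qed

text \<open>An additive operation sends a zero arrow to an idempotent for addition; this is how
  composition and suspension are shown to preserve zero arrows.\<close>

lemma idempotent_Add_eq_Zero:
  assumes "f \<in> Arr A" "f \<boxplus> f = f"
  shows "f = Zero A (Dom A f) (Cod A f)"
proof -
  have "Neg A f \<boxplus> (f \<boxplus> f) = f" using assms(1) by simp
  moreover have "Neg A f \<boxplus> f = Zero A (Dom A f) (Cod A f)" using assms(1) by simp
  ultimately show ?thesis using assms(2) by simp
qed

lemma Comp_Add [simp]: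
  assumes "f \<in> Arr A" "f' \<in> Arr A" "g \<in> Arr A" "Dom A f = Dom A f'" "Cod A f = Dom A g"
    "Cod A f' = Dom A g"
  shows "g \<cdot> (f \<boxplus> f') = g \<cdot> f \<boxplus> g \<cdot> f'"
  using comp_add[of f "Dom A f" "Cod A f" f' g "Cod A g"] assms by simp

lemma Add_Comp [simp]:
  assumes "f \<in> Arr A" "g \<in> Arr A" "g' \<in> Arr A" "Dom A g = Cod A f" "Dom A g' = Cod A f"
    "Cod A g = Cod A g'"
  shows "(g \<boxplus> g') \<cdot> f = g \<cdot> f \<boxplus> g' \<cdot> f"
  using add_comp[of f "Dom A f" "Cod A f" g "Cod A g" g'] assms by simp

lemma Comp_Zero [simp]:
  assumes "g \<in> Arr A" "Dom A g = Y" "X \<in> Obj A"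
  shows "g \<cdot> Zero A X Y = Zero A X (Cod A g)"
proof -
  have Y: "Y \<in> Obj A" using assms by auto
  have "g \<cdot> Zero A X Y \<boxplus> g \<cdot> Zero A X Y = g \<cdot> (Zero A X Y \<boxplus> Zero A X Y)"
    by (subst Comp_Add) (use assms Y in simp_all)
  also have "\<dots> = g \<cdot> Zero A X Y" using assms Y by simp
  finally show ?thesis using idempotent_Add_eq_Zero[of "g \<cdot> Zero A X Y"] assms Y by simp
qed

lemma Zero_Comp [simp]:
  assumes "f \<in> Arr A" "Cod A f = Y" "Z \<in> Obj A"
  shows "Zero A Y Z \<cdot> f = Zero A (Dom A f) Z"
proof -
  have Y: "Y \<in> Obj A" using assms by auto
  have "Zero A Y Z \<cdot> f \<boxplus> Zero A Y Z \<cdot> f = (Zero A Y Z \<boxplus> Zero A Y Z) \<cdot> f"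
    by (subst Add_Comp) (use assms Y in simp_all)
  also have "\<dots> = Zero A Y Z \<cdot> f" using assms Y by simp
  finally show ?thesis using idempotent_Add_eq_Zero[of "Zero A Y Z \<cdot> f"] assms Y by simp
qed

lemma Comp_Neg [simp]:
  assumes "f \<in> Arr A" "g \<in> Arr A" "Cod A f = Dom A g"
  shows "g \<cdot> Neg A f = Neg A (g \<cdot> f)"
proof (rule Neg_unique)
  have "g \<cdot> f \<boxplus> g \<cdot> Neg A f = g \<cdot> (f \<boxplus> Neg A f)"
    by (subst Comp_Add) (use assms in simp_all)
  also have "\<dots> = Zero A (Dom A f) (Cod A g)" using assms by simp
  finally show "g \<cdot> f \<boxplus> g \<cdot> Neg A f = Zero A (Dom A (g \<cdot> Neg A f)) (Cod A (g \<cdot> Neg A f))"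
    using assms by simp
qed (use assms in simp_all)

lemma Neg_Comp [simp]:
  assumes "f \<in> Arr A" "g \<in> Arr A" "Cod A f = Dom A g"
  shows "Neg A g \<cdot> f = Neg A (g \<cdot> f)"
proof (rule Neg_unique)
  have "g \<cdot> f \<boxplus> Neg A g \<cdot> f = (g \<boxplus> Neg A g) \<cdot> f"
    by (subst Add_Comp) (use assms in simp_all)
  also have "\<dots> = Zero A (Dom A f) (Cod A g)" using assms by simp
  finally show "g \<cdot> f \<boxplus> Neg A g \<cdot> f = Zero A (Dom A (Neg A g \<cdot> f)) (Cod A (Neg A g \<cdot> f))"
    using assms by simp
qed (use assms in simp_all)

lemma Comp_eq_Zero:
  assumes "g \<cdot> f = Zero A X Z" "f \<in> Arr A" "g \<in> Arr A" "t \<in> Arr A"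
    "Cod A f = Dom A g" "Cod A t = Dom A f" "Dom A f = X" "Cod A g = Z"
  shows "g \<cdot> (f \<cdot> t) = Zero A (Dom A t) Z"
  using assms by (auto simp: Comp_eq_Comp[OF assms(1)])

lemma iso_Neg_Id: "X \<in> Obj A \<Longrightarrow> iso_arrow A (Neg A (Id A X))"
  by (rule iso_arrowI[where g = "Neg A (Id A X)"]) auto

section \<open>Direct sums and matrices\<close>

lemma dsum_arrows [simp]:
  assumes "X \<in> Obj A" "Y \<in> Obj A"
  shows "Dsum A X Y \<in> Obj A"
    "Inj1 A X Y \<in> Arr A" "Dom A (Inj1 A X Y) = X" "Cod A (Inj1 A X Y) = Dsum A X Y"
    "Inj2 A X Y \<in> Arr A" "Dom A (Inj2 A X Y) = Y" "Cod A (Inj2 A X Y) = Dsum A X Y"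
    "Proj1 A X Y \<in> Arr A" "Dom A (Proj1 A X Y) = Dsum A X Y" "Cod A (Proj1 A X Y) = X"
    "Proj2 A X Y \<in> Arr A" "Dom A (Proj2 A X Y) = Dsum A X Y" "Cod A (Proj2 A X Y) = Y"
  using inj1_hom[OF assms] inj2_hom[OF assms] proj1_hom[OF assms] proj2_hom[OF assms] dsum_obj[OF assms]
  by simp_all

lemma proj_inj [simp]:
  assumes "X \<in> Obj A" "Y \<in> Obj A"
  shows "Proj1 A X Y \<cdot> Inj1 A X Y = Id A X" "Proj2 A X Y \<cdot> Inj2 A X Y = Id A Y"
    "Proj1 A X Y \<cdot> Inj2 A X Y = Zero A Y X" "Proj2 A X Y \<cdot> Inj1 A X Y = Zero A X Y"
  by (fact proj1_inj1[OF assms] proj2_inj2[OF assms] proj1_inj2[OF assms] proj2_inj1[OF assms])+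

lemma proj_inj_Comp [simp]:
  assumes "X \<in> Obj A" "Y \<in> Obj A" "t \<in> Arr A"
  shows "Cod A t = X \<Longrightarrow> Proj1 A X Y \<cdot> (Inj1 A X Y \<cdot> t) = t"
    "Cod A t = Y \<Longrightarrow> Proj2 A X Y \<cdot> (Inj2 A X Y \<cdot> t) = t"
    "Cod A t = Y \<Longrightarrow> Proj1 A X Y \<cdot> (Inj2 A X Y \<cdot> t) = Zero A (Dom A t) X"
    "Cod A t = X \<Longrightarrow> Proj2 A X Y \<cdot> (Inj1 A X Y \<cdot> t) = Zero A (Dom A t) Y"
  using assms by (simp_all add: Comp_eq_Comp[OF proj_inj(1)] Comp_eq_Comp[OF proj_inj(2)]
      Comp_eq_Comp[OF proj_inj(3)] Comp_eq_Comp[OF proj_inj(4)])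

lemma inj_proj_Comp:
  assumes "X \<in> Obj A" "Y \<in> Obj A" "t \<in> Arr A" "Cod A t = Dsum A X Y"
  shows "Inj1 A X Y \<cdot> (Proj1 A X Y \<cdot> t) \<boxplus> Inj2 A X Y \<cdot> (Proj2 A X Y \<cdot> t) = t"
proof -
  have "(Inj1 A X Y \<cdot> Proj1 A X Y \<boxplus> Inj2 A X Y \<cdot> Proj2 A X Y) \<cdot> t = t"
    using assms by (simp add: inj_proj del: Add_Comp)
  then show ?thesis using assms by (simp add: Comp_assoc)
qed

lemma Comp_inj_proj:
  assumes "X \<in> Obj A" "Y \<in> Obj A" "t \<in> Arr A" "Dom A t = Dsum A X Y"
  shows "(t \<cdot> Inj1 A X Y) \<cdot> Proj1 A X Y \<boxplus> (t \<cdot> Inj2 A X Y) \<cdot> Proj2 A X Y = t"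
proof -
  have "t \<cdot> (Inj1 A X Y \<cdot> Proj1 A X Y \<boxplus> Inj2 A X Y \<cdot> Proj2 A X Y) = t"
    using assms by (simp add: inj_proj del: Comp_Add)
  then show ?thesis using assms by (simp add: Comp_assoc)
qed

text \<open>The identity of a direct sum is the sum of its two injection-projection idempotents, so
  the injections are jointly epic. Matrix identities are checked column by column through
  this.\<close>

lemma dsum_eqI_inj:
  assumes "X \<in> Obj A" "Y \<in> Obj A" "s \<in> Arr A" "t \<in> Arr A"
    "Dom A s = Dsum A X Y" "Dom A t = Dsum A X Y"
    and "s \<cdot> Inj1 A X Y = t \<cdot> Inj1 A X Y" "s \<cdot> Inj2 A X Y = t \<cdot> Inj2 A X Y"
  shows "s = t"
  using Comp_inj_proj[OF assms(1,2,3,5)] Comp_inj_proj[OF assms(1,2,4,6)] assms(7,8) by metis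

lemma Col_arrow [simp]:
  assumes "f \<in> Arr A" "g \<in> Arr A" "Dom A f = Dom A g"
  shows "Col A f g \<in> Arr A" "Dom A (Col A f g) = Dom A g"
    "Cod A (Col A f g) = Dsum A (Cod A f) (Cod A g)"
  using assms by (simp_all add: Col_def)

lemma Row_arrow [simp]:
  assumes "f \<in> Arr A" "g \<in> Arr A" "Cod A f = Cod A g"
  shows "Row A f g \<in> Arr A" "Dom A (Row A f g) = Dsum A (Dom A f) (Dom A g)"
    "Cod A (Row A f g) = Cod A g"
  using assms by (simp_all add: Row_def)

lemma Row_inj:
  assumes "f \<in> Arr A" "g \<in> Arr A" "Cod A f = Cod A g" "Dom A f = X" "Dom A g = Y"
  shows "Row A f g \<cdot> Inj1 A X Y = f" "Row A f g \<cdot> Inj2 A X Y = g"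
  using assms by (auto simp: Row_def Comp_assoc)

lemma Row_Col:
  assumes "f \<in> Arr A" "g \<in> Arr A" "f' \<in> Arr A" "g' \<in> Arr A"
    "Cod A f = Cod A g" "Dom A f' = Dom A g'" "Cod A f' = Dom A f" "Cod A g' = Dom A g"
  shows "Row A f g \<cdot> Col A f' g' = f \<cdot> f' \<boxplus> g \<cdot> g'"
  using assms by (simp add: Row_def Col_def Comp_assoc)

lemma Add_Neg_eq_Zero:
  assumes "f \<in> Arr A" "g \<in> Arr A" "Dom A f = Dom A g" "Cod A f = Cod A g"
    and "f \<boxplus> Neg A g = Zero A (Dom A g) (Cod A g)"
  shows "f = g"
proof -
  have "Neg A g = Neg A f" using Neg_unique[of f "Neg A g"] assms by simp
  then show ?thesis using assms(1,2) by (metis Neg_Neg)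
qed

text \<open>Exactness of \<open>Hom(S, _)\<close> at the middle term for all \<open>S\<close>,
  without the condition that \<open>q \<cdot> p\<close> vanishes; the factorisation need not be
  unique.\<close>

definition weak_kernel :: "'b \<Rightarrow> 'b \<Rightarrow> bool" where
  "weak_kernel p q \<longleftrightarrow> (\<forall>s \<in> Arr A. Cod A s = Dom A q \<and> q \<cdot> s = Zero A (Dom A s) (Cod A q) \<longrightarrow>
     (\<exists>r \<in> Arr A. Dom A r = Dom A s \<and> Cod A r = Dom A p \<and> p \<cdot> r = s))"

lemma weak_kernelE:
  assumes "weak_kernel p q" "s \<in> Arr A" "Cod A s = Dom A q" "q \<cdot> s = Zero A (Dom A s) (Cod A q)"
  obtains r where "r \<in> Arr A" "Dom A r = Dom A s" "Cod A r = Dom A p" "p \<cdot> r = s"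
  using assms unfolding weak_kernel_def by blast

end

section \<open>Exact triangles\<close>

context triangulated_category
begin

section \<open>The suspension as an additive, full and faithful functor\<close>

lemma category_T: "category T"
  by unfold_locales

lemma susp_functor: "is_functor T T (SuspO T) (SuspA T)"
  using susp_equivalence unfolding is_equivalence_def by blast

lemma SuspO_obj [simp]: "X \<in> Obj T \<Longrightarrow> SuspO T X \<in> Obj T"
  using susp_functor unfolding is_functor_def by blast

lemma SuspA_Id [simp]: "X \<in> Obj T \<Longrightarrow> SuspA T (Id T X) = Id T (SuspO T X)"
  using susp_functor unfolding is_functor_def by blast

lemma SuspA_arrow [simp]:
  assumes "f \<in> Arr T"
  shows "SuspA T f \<in> Arr T" "Dom T (SuspA T f) = SuspO T (Dom T f)"
    "Cod T (SuspA T f) = SuspO T (Cod T f)"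
proof -
  have "f \<in> Hom T (Dom T f) (Cod T f)" using assms by simp
  then have "SuspA T f \<in> Hom T (SuspO T (Dom T f)) (SuspO T (Cod T f))"
    using susp_functor unfolding is_functor_def by blast
  then show "SuspA T f \<in> Arr T" "Dom T (SuspA T f) = SuspO T (Dom T f)"
    "Cod T (SuspA T f) = SuspO T (Cod T f)" by simp_all
qed

lemma SuspA_Comp [simp]:
  assumes "f \<in> Arr T" "g \<in> Arr T" "Cod T f = Dom T g"
  shows "SuspA T (g \<cdot> f) = SuspA T g \<cdot> SuspA T f"
proof -
  have "f \<in> Hom T (Dom T f) (Dom T g)" "g \<in> Hom T (Dom T g) (Cod T g)" using assms by simp_all
  then show ?thesis using susp_functor unfolding is_functor_def by blast
qed

lemma SuspA_Add [simp]:
  assumes "f \<in> Arr T" "g \<in> Arr T" "Dom T f = Dom T g" "Cod T f = Cod T g"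
  shows "SuspA T (f \<boxplus> g) = SuspA T f \<boxplus> SuspA T g"
  using susp_add[of f "Dom T g" "Cod T g" g] assms by simp

lemma SuspA_Zero [simp]:
  assumes "X \<in> Obj T" "Y \<in> Obj T"
  shows "SuspA T (Zero T X Y) = Zero T (SuspO T X) (SuspO T Y)"
proof -
  have "SuspA T (Zero T X Y) \<boxplus> SuspA T (Zero T X Y) = SuspA T (Zero T X Y \<boxplus> Zero T X Y)"
    by (subst SuspA_Add) (use assms in simp_all)
  also have "\<dots> = SuspA T (Zero T X Y)" using assms by simp
  finally show ?thesis using idempotent_Add_eq_Zero[of "SuspA T (Zero T X Y)"] assms by simp
qed

lemma SuspA_Neg [simp]:
  assumes "f \<in> Arr T"
  shows "SuspA T (Neg T f) = Neg T (SuspA T f)"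
proof (rule Neg_unique)
  have "SuspA T f \<boxplus> SuspA T (Neg T f) = SuspA T (f \<boxplus> Neg T f)"
    by (subst SuspA_Add) (use assms in simp_all)
  also have "\<dots> = Zero T (SuspO T (Dom T f)) (SuspO T (Cod T f))" using assms by simp
  finally show "SuspA T f \<boxplus> SuspA T (Neg T f)
      = Zero T (Dom T (SuspA T (Neg T f))) (Cod T (SuspA T (Neg T f)))"
    using assms by simp
qed (use assms in simp_all)

lemma SuspA_faithful:
  assumes "f \<in> Arr T" "g \<in> Arr T" "Dom T f = Dom T g" "Cod T f = Cod T g"
    and "SuspA T f = SuspA T g"
  shows "f = g"
  using equivalence_faithful[OF category_T susp_equivalence,
      of f "Dom T g" "Cod T g" g] assms by simp

lemma SuspA_full:
  assumes "X \<in> Obj T" "Y \<in> Obj T" "t \<in> Arr T" "Dom T t = SuspO T X" "Cod T t = SuspO T Y"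
  obtains f where "f \<in> Arr T" "Dom T f = X" "Cod T f = Y" "SuspA T f = t"
  using equivalence_full[OF category_T category_T susp_equivalence assms(1,2), of t] assms(3-5)
  by auto

section \<open>Rotation and weak kernels in exact triangles\<close>

lemma exactD:
  assumes "Exact T u v w"
  shows "u \<in> Arr T" "v \<in> Arr T" "w \<in> Arr T" "Dom T v = Cod T u" "Dom T w = Cod T v"
    "Cod T w = SuspO T (Dom T u)"
    "v \<cdot> u = Zero T (Dom T u) (Cod T v)" "w \<cdot> v = Zero T (Cod T u) (SuspO T (Dom T u))"
    "SuspA T u \<cdot> w = Zero T (Cod T v) (SuspO T (Cod T u))"
  using exact_candidate[OF assms] unfolding candidate_triangle_def diagram_def by auto

lemma candidate_triangleI:
  assumes "u \<in> Arr T" "v \<in> Arr T" "w \<in> Arr T" "Dom T v = Cod T u" "Dom T w = Cod T v"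
    "Cod T w = SuspO T (Dom T u)"
    "v \<cdot> u = Zero T (Dom T u) (Cod T v)" "w \<cdot> v = Zero T (Cod T u) (SuspO T (Dom T u))"
    "SuspA T u \<cdot> w = Zero T (Cod T v) (SuspO T (Cod T u))"
  shows "candidate_triangle T u v w"
  using assms unfolding candidate_triangle_def diagram_def by auto

lemma exact_rotateI:
  assumes "Exact T u v w"
  shows "Exact T v w (Neg T (SuspA T u))"
  using exact_rotate[of u v w] exact_candidate[OF assms] assms
  unfolding candidate_triangle_def by blast

text \<open>The rotation axiom speaks only of diagrams, so the types of \<open>u\<close> have to be
  supplied; those of \<open>v\<close> and \<open>w\<close> come from exactness.\<close>

lemma exact_unrotate:
  assumes "Exact T v w (Neg T (SuspA T u))" "u \<in> Arr T" "Cod T u = Dom T v"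
    "Cod T w = SuspO T (Dom T u)"
  shows "Exact T u v w"
proof -
  have "diagram T u v w" using exactD(1-6)[OF assms(1)] assms(2-4)
    unfolding diagram_def by auto
  then show ?thesis using exact_rotate assms(1) by blast
qed

text \<open>An arrow \<open>s\<close> killed by \<open>v\<close> gives a commutative square from the
  rotated identity triangle on the source of \<open>s\<close> to the rotated triangle
  \<open>E\<close>. Rotation makes the component supplied by \<open>exact_fill\<close> an arrow
  \<open>k\<close> between suspensions; fullness desuspends it to \<open>r\<close>, and faithfulness
  turns the resulting equation into \<open>u \<cdot> r = s\<close>.\<close>

lemma exact_weak_kernel:
  assumes E: "Exact T u v w"
  shows "weak_kernel u v"
  unfolding weak_kernel_def
proof (intro ballI impI, elim conjE)
  fix s assume s: "s \<in> Arr T" "Cod T s = Dom T v" "v \<cdot> s = Zero T (Dom T s) (Cod T v)"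
  note e = exactD[OF E]
  obtain N where N: "zero_object T N" using ex_zero_object by blast
  then have [simp]: "N \<in> Obj T" unfolding zero_object_def by blast
  have "Exact T (Id T (Dom T s)) (Zero T (Dom T s) N) (Zero T N (SuspO T (Dom T s)))"
    using exact_id N s by simp
  note E1 = exact_rotateI[OF this]
  note E2 = exact_rotateI[OF E]
  obtain k where "diagram_map T (Zero T (Dom T s) N) (Zero T N (SuspO T (Dom T s)))
      (Neg T (SuspA T (Id T (Dom T s)))) v w (Neg T (SuspA T u)) s (Zero T N (Cod T v)) k"
    using exact_fill[OF E1 E2, of s "Zero T N (Cod T v)"] s e by auto
  then have k: "k \<in> Arr T" "Dom T k = SuspO T (Dom T s)" "Cod T k = SuspO T (Dom T u)"
    "SuspA T s \<cdot> Neg T (Id T (SuspO T (Dom T s))) = Neg T (SuspA T u) \<cdot> k"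
    unfolding diagram_map_def using s e by simp_all
  obtain r where r: "r \<in> Arr T" "Dom T r = Dom T s" "Cod T r = Dom T u" "SuspA T r = k"
    using SuspA_full[of "Dom T s" "Dom T u" k] s e k by auto
  have "Neg T (SuspA T s) = Neg T (SuspA T (u \<cdot> r))" using k r s e by simp
  then have "SuspA T s = SuspA T (u \<cdot> r)" using r s e by (metis Neg_Neg Comp_arrow(1) SuspA_arrow(1))
  then have "u \<cdot> r = s" using SuspA_faithful[of s "u \<cdot> r"] r s e by simp
  with r show "\<exists>r\<in>Arr T. Dom T r = Dom T s \<and> Cod T r = Dom T u \<and> u \<cdot> r = s" by blast
qed

text \<open>The five lemma for \<open>Hom(S, _)\<close>, carried out by hand: \<open>\<phi>\<close>
  compares the cone of \<open>a\<close> with the third object of the given diagram, and the weak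
  kernels are exactly what the chase consumes. Exactness is then transported along
  \<open>\<phi>\<close>.\<close>

lemma exact_criterion:
  assumes E: "Exact T a b\<^sub>1 c\<^sub>1"
    and ar: "c \<in> Arr T" "\<phi> \<in> Arr T" "Dom T \<phi> = Cod T b\<^sub>1" "Cod T \<phi> = Dom T c"
    and b: "\<phi> \<cdot> b\<^sub>1 = b" and c: "c \<cdot> \<phi> = c\<^sub>1"
    and ab: "weak_kernel a b" and bc: "weak_kernel b c"
    and ca: "SuspA T a \<cdot> c = Zero T (Dom T c) (SuspO T (Cod T a))"
  shows "iso_arrow T \<phi>" "Exact T a b c"
proof -
  note e = exactD[OF E]
  have cc: "Cod T c = SuspO T (Dom T a)" using Comp_arrow(3)[of \<phi> c] c ar e(6) by simp
  have bar: "b \<in> Arr T" "Dom T b = Cod T a" "Cod T b = Dom T c" using b ar e by auto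
  \<comment> \<open>Injectivity: \<open>t\<close> factors as \<open>b\<^sub>1 \<cdot> s\<close>,
    then \<open>s\<close> factors through \<open>a\<close>, and
    \<open>b\<^sub>1 \<cdot> a = 0\<close>.\<close>
  have mono: "t = Zero T (Dom T t) (Dom T \<phi>)"
    if t: "t \<in> Arr T" "Cod T t = Dom T \<phi>" "\<phi> \<cdot> t = Zero T (Dom T t) (Cod T \<phi>)" for t
  proof -
    have "c\<^sub>1 \<cdot> t = c \<cdot> (\<phi> \<cdot> t)" using Comp_eq_Comp[OF c, of t] ar t(1,2) by simp
    also have "\<dots> = Zero T (Dom T t) (Cod T c)" using t ar by simp
    finally obtain s where s: "s \<in> Arr T" "Dom T s = Dom T t" "Cod T s = Dom T b\<^sub>1" "b\<^sub>1 \<cdot> s = t"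
      using weak_kernelE[OF exact_weak_kernel[OF exact_rotateI[OF E]], of t] t e ar cc by metis
    have "b \<cdot> s = \<phi> \<cdot> t" using Comp_eq_Comp[OF b, of s] s e ar by simp
    then obtain r where r: "r \<in> Arr T" "Dom T r = Dom T s" "Cod T r = Dom T a" "a \<cdot> r = s"
      using weak_kernelE[OF ab, of s] s t bar ar e by metis
    have "t = b\<^sub>1 \<cdot> (a \<cdot> r)" using r s by simp
    also have "\<dots> = Zero T (Dom T t) (Dom T \<phi>)"
      using Comp_eq_Zero[OF e(7), of r] r s e ar by simp
    finally show ?thesis .
  qed
  \<comment> \<open>Surjectivity, applied to the identity: \<open>c\<close> lifts through
    \<open>c\<^sub>1\<close> to \<open>t\<^sub>0\<close> by exactness of \<open>E\<close> rotated
    twice. The error \<open>?d\<close> of \<open>t\<^sub>0\<close> as a right inverse is killed by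
    \<open>c\<close>, hence comes from \<open>b\<close>, and is corrected by
    \<open>b\<^sub>1 \<cdot> s\<close>.\<close>
  have "Neg T (SuspA T a) \<cdot> c = Zero T (Dom T c) (Cod T (Neg T (SuspA T a)))"
    using ca cc ar e by simp
  then obtain t\<^sub>0 where t0: "t\<^sub>0 \<in> Arr T" "Dom T t\<^sub>0 = Dom T c" "Cod T t\<^sub>0 = Dom T c\<^sub>1" "c\<^sub>1 \<cdot> t\<^sub>0 = c"
    using weak_kernelE[OF exact_weak_kernel[OF exact_rotateI[OF exact_rotateI[OF E]]], of c]
      ar cc e by (metis Neg_arrow(2) SuspA_arrow(1,2))
  let ?d = "Id T (Dom T c) \<boxplus> Neg T (\<phi> \<cdot> t\<^sub>0)"
  have d: "?d \<in> Arr T" "Dom T ?d = Dom T c" "Cod T ?d = Dom T c" using t0 ar e by simp_all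
  have "c \<cdot> ?d = Zero T (Dom T ?d) (Cod T c)"
    using t0 ar e by (simp add: Comp_eq_Comp[OF c])
  then obtain s where s: "s \<in> Arr T" "Dom T s = Dom T ?d" "Cod T s = Dom T b" "b \<cdot> s = ?d"
    using weak_kernelE[OF bc, of ?d] d by metis
  define t where "t = t\<^sub>0 \<boxplus> b\<^sub>1 \<cdot> s"
  have t: "t \<in> Arr T" "Dom T t = Dom T c" "Cod T t = Dom T \<phi>"
    unfolding t_def using t0 s d bar e ar by simp_all
  have "\<phi> \<cdot> t = \<phi> \<cdot> t\<^sub>0 \<boxplus> ?d"
    unfolding t_def using t0 s d bar e ar by (simp add: Comp_eq_Comp[OF b])
  also have "\<dots> = Id T (Dom T c)" using t0 e ar by (simp add: Add_left_comm[of "\<phi> \<cdot> t\<^sub>0"])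
  finally have right: "\<phi> \<cdot> t = Id T (Dom T c)" .
  \<comment> \<open>A right inverse of an arrow with zero kernel is also a left inverse:
    \<open>t \<cdot> \<phi> - Id\<close> is killed by \<open>\<phi>\<close>.\<close>
  have "\<phi> \<cdot> (t \<cdot> \<phi> \<boxplus> Neg T (Id T (Dom T \<phi>))) = Zero T (Dom T \<phi>) (Cod T \<phi>)"
    using t ar e by (simp add: Comp_eq_Comp[OF right])
  then have "t \<cdot> \<phi> \<boxplus> Neg T (Id T (Dom T \<phi>)) = Zero T (Dom T \<phi>) (Dom T \<phi>)"
    using mono[of "t \<cdot> \<phi> \<boxplus> Neg T (Id T (Dom T \<phi>))"] t ar e by simp
  then have left: "t \<cdot> \<phi> = Id T (Dom T \<phi>)"
    using Add_Neg_eq_Zero[of "t \<cdot> \<phi>" "Id T (Dom T \<phi>)"] t ar e by simp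
  show iso: "iso_arrow T \<phi>"
    using iso_arrowI[of \<phi> t] left right t ar by simp
  have "candidate_triangle T a b c"
  proof (rule candidate_triangleI)
    show "b \<cdot> a = Zero T (Dom T a) (Cod T b)"
      unfolding b[symmetric] using e ar by (simp add: Comp_assoc)
    show "c \<cdot> b = Zero T (Cod T a) (SuspO T (Dom T a))"
      unfolding b[symmetric] using e ar by (simp add: Comp_eq_Comp[OF c])
  qed (use e bar ar cc ca in simp_all)
  moreover have "diagram_map T a b\<^sub>1 c\<^sub>1 a b c (Id T (Dom T a)) (Id T (Cod T a)) \<phi>"
    unfolding diagram_map_def using e bar ar b c by simp
  ultimately show "Exact T a b c"
    using exact_iso[OF E] iso e by auto
qed

text \<open>Uniqueness of the cone: the filler between two triangles on the same arrow satisfies the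
  hypotheses of \<open>exact_criterion\<close>, because the second triangle has weak
  kernels.\<close>

lemma exact_comparison:
  assumes E: "Exact T a b c" and E': "Exact T a b' c'"
  obtains \<theta> where "iso_arrow T \<theta>" "Dom T \<theta> = Cod T b" "Cod T \<theta> = Cod T b'"
    "\<theta> \<cdot> b = b'" "c' \<cdot> \<theta> = c"
proof -
  note e = exactD[OF E] and e' = exactD[OF E']
  obtain \<theta> where "diagram_map T a b c a b' c' (Id T (Dom T a)) (Id T (Cod T a)) \<theta>"
    using exact_fill[OF E E', of "Id T (Dom T a)" "Id T (Cod T a)"] e e' by auto
  then have \<theta>: "\<theta> \<in> Arr T" "Dom T \<theta> = Cod T b" "Cod T \<theta> = Cod T b'" "\<theta> \<cdot> b = b'" "c' \<cdot> \<theta> = c"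
    unfolding diagram_map_def using e e' by simp_all
  moreover have "iso_arrow T \<theta>"
    using exact_criterion(1)[OF E _ _ _ _ \<theta>(4,5)] exact_weak_kernel[OF E']
      exact_weak_kernel[OF exact_rotateI[OF E']] e' \<theta> by simp
  ultimately show ?thesis using that by blast
qed

text \<open>The inverse \<open>\<theta>'\<close> is an explicit argument because the new third arrow
  is written with it.\<close>

lemma exact_change_third:
  assumes E: "Exact T a b c"
    and \<theta>: "\<theta> \<in> Arr T" "Dom T \<theta> = Cod T b"
    and \<theta>': "\<theta>' \<in> Arr T" "Dom T \<theta>' = Cod T \<theta>" "Cod T \<theta>' = Dom T \<theta>"
    and inv: "\<theta>' \<cdot> \<theta> = Id T (Dom T \<theta>)" "\<theta> \<cdot> \<theta>' = Id T (Cod T \<theta>)"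
  shows "Exact T a (\<theta> \<cdot> b) (c \<cdot> \<theta>')"
proof -
  note e = exactD[OF E]
  have "candidate_triangle T a (\<theta> \<cdot> b) (c \<cdot> \<theta>')"
  proof (rule candidate_triangleI)
    show "(c \<cdot> \<theta>') \<cdot> (\<theta> \<cdot> b) = Zero T (Cod T a) (SuspO T (Dom T a))"
      using e \<theta> \<theta>' by (simp add: Comp_assoc Comp_eq_Comp[OF inv(1)])
    show "SuspA T a \<cdot> (c \<cdot> \<theta>') = Zero T (Cod T (\<theta> \<cdot> b)) (SuspO T (Cod T a))"
      using Comp_eq_Zero[OF e(9), of \<theta>'] e \<theta> \<theta>' by simp
  qed (use e \<theta> \<theta>' in \<open>simp_all add: Comp_assoc\<close>)
  moreover have "diagram_map T a b c a (\<theta> \<cdot> b) (c \<cdot> \<theta>') (Id T (Dom T a)) (Id T (Cod T a)) \<theta>"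
    unfolding diagram_map_def using e \<theta> \<theta>' inv by (simp add: Comp_assoc)
  moreover have "iso_arrow T \<theta>" using iso_arrowI[of \<theta> \<theta>'] \<theta> \<theta>' inv by simp
  ultimately show ?thesis using exact_iso[OF E] e by auto
qed

text \<open>Minus the identity on the middle object is an isomorphism and changes the sign of both
  neighbouring arrows. It clears the signs that rotation introduces.\<close>

lemma exact_Neg_Neg:
  assumes E: "Exact T a b c"
  shows "Exact T (Neg T a) (Neg T b) c"
proof -
  note e = exactD[OF E]
  have "candidate_triangle T (Neg T a) (Neg T b) c"
    by (rule candidate_triangleI) (use e in simp_all)
  moreover have "diagram_map T a b c (Neg T a) (Neg T b) c
      (Id T (Dom T a)) (Neg T (Id T (Cod T a))) (Id T (Cod T b))"
    unfolding diagram_map_def using e by simp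
  ultimately show ?thesis using exact_iso[OF E] e iso_Neg_Id by auto
qed

text \<open>The cone \<open>j\<close> of the injection has zero connecting arrow, so
  \<open>j\<close> has a section \<open>s\<close>; the comparison with the second projection is
  \<open>Proj2 T X Y \<cdot> s\<close>.\<close>

lemma exact_split:
  assumes [simp]: "X \<in> Obj T" "Y \<in> Obj T"
  shows "Exact T (Inj1 T X Y) (Proj2 T X Y) (Zero T Y (SuspO T X))"
proof -
  obtain j d where "Exact T (Inj1 T X Y) j d"
    using exact_ex[of "Inj1 T X Y" X "Dsum T X Y"] by auto
  note E = this
  note e = exactD[OF E]
  have [simp]: "j \<in> Arr T" "d \<in> Arr T" "Dom T j = Dsum T X Y" "Dom T d = Cod T j"
    "Cod T d = SuspO T X" using e by simp_all
  \<comment> \<open>The suspended injection has a left inverse, and it kills \<open>d\<close>; hence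
    \<open>d\<close> is zero.\<close>
  have "SuspA T (Proj1 T X Y) \<cdot> SuspA T (Inj1 T X Y) = Id T (SuspO T X)"
    by (subst SuspA_Comp[symmetric]) simp_all
  from Comp_eq_Comp[OF this, of d] have "d = Zero T (Cod T j) (SuspO T X)"
    using e(9) by simp
  note d = this
  obtain s where s: "s \<in> Arr T" "Dom T s = Cod T j" "Cod T s = Dsum T X Y" "j \<cdot> s = Id T (Cod T j)"
    using weak_kernelE[OF exact_weak_kernel[OF exact_rotateI[OF E]], of "Id T (Cod T j)"] d by auto
  \<comment> \<open>The difference of \<open>s \<cdot> j\<close> and the identity is killed by
    \<open>j\<close>, so it factors through \<open>Inj1\<close> and vanishes after
    \<open>Proj2\<close>.\<close>
  have "j \<cdot> (s \<cdot> j \<boxplus> Neg T (Id T (Dsum T X Y))) = Zero T (Dsum T X Y) (Cod T j)"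
    using s by (simp add: Comp_eq_Comp[OF s(4)])
  then obtain r where r: "r \<in> Arr T" "Dom T r = Dsum T X Y" "Cod T r = X"
      "Inj1 T X Y \<cdot> r = s \<cdot> j \<boxplus> Neg T (Id T (Dsum T X Y))"
    using weak_kernelE[OF exact_weak_kernel[OF E], of "s \<cdot> j \<boxplus> Neg T (Id T (Dsum T X Y))"] s by auto
  have "Proj2 T X Y \<cdot> (s \<cdot> j) \<boxplus> Neg T (Proj2 T X Y) = Proj2 T X Y \<cdot> (Inj1 T X Y \<cdot> r)"
    unfolding r(4) using s by simp
  also have "\<dots> = Zero T (Dsum T X Y) Y" using r(1-3) by simp
  finally have "Proj2 T X Y \<cdot> (s \<cdot> j) = Proj2 T X Y"
    using Add_Neg_eq_Zero[of "Proj2 T X Y \<cdot> (s \<cdot> j)" "Proj2 T X Y"] s by simp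
  then have "(Proj2 T X Y \<cdot> s) \<cdot> j = Proj2 T X Y" using s by (simp add: Comp_assoc)
  note crit = exact_criterion(2)[OF E _ _ _ _ this, of "Zero T Y (SuspO T X)"]
  show ?thesis
  proof (rule crit)
    show "weak_kernel (Inj1 T X Y) (Proj2 T X Y)" unfolding weak_kernel_def
    proof (intro ballI impI, elim conjE)
      fix t assume t: "t \<in> Arr T" "Cod T t = Dom T (Proj2 T X Y)"
        "Proj2 T X Y \<cdot> t = Zero T (Dom T t) (Cod T (Proj2 T X Y))"
      then have "Inj1 T X Y \<cdot> (Proj1 T X Y \<cdot> t) = t"
        using inj_proj_Comp[of X Y t] by simp
      then show "\<exists>r\<in>Arr T. Dom T r = Dom T t \<and> Cod T r = Dom T (Inj1 T X Y) \<and> Inj1 T X Y \<cdot> r = t"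
        using t by (intro bexI[of _ "Proj1 T X Y \<cdot> t"]) simp_all
    qed
    show "weak_kernel (Proj2 T X Y) (Zero T Y (SuspO T X))" unfolding weak_kernel_def
    proof (intro ballI impI, elim conjE)
      fix t assume "t \<in> Arr T" "Cod T t = Dom T (Zero T Y (SuspO T X))"
      then show "\<exists>r\<in>Arr T. Dom T r = Dom T t \<and> Cod T r = Dom T (Proj2 T X Y) \<and> Proj2 T X Y \<cdot> r = t"
        by (intro bexI[of _ "Inj2 T X Y \<cdot> t"]) simp_all
    qed
  qed (use s d in simp_all)
qed

text \<open>A retract inherits weak kernels: an arrow is pushed along the \<open>i\<close>
  components, factored in the exact triangle and brought back along the \<open>r\<close> components.
  The candidate condition supplies the remaining vanishing, so \<open>exact_criterion\<close>
  applies.\<close>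

lemma exact_retract:
  assumes E: "Exact T u' v' w'" and C: "candidate_triangle T u v w"
    and i: "diagram_map T u v w u' v' w' i\<^sub>1 i\<^sub>2 i\<^sub>3"
    and r: "diagram_map T u' v' w' u v w r\<^sub>1 r\<^sub>2 r\<^sub>3"
    and ri: "r\<^sub>1 \<cdot> i\<^sub>1 = Id T (Dom T u)" "r\<^sub>2 \<cdot> i\<^sub>2 = Id T (Dom T v)" "r\<^sub>3 \<cdot> i\<^sub>3 = Id T (Dom T w)"
  shows "Exact T u v w"
proof -
  note e = exactD[OF E]
  have c [simp]: "u \<in> Arr T" "v \<in> Arr T" "w \<in> Arr T" "Dom T v = Cod T u" "Dom T w = Cod T v"
    "Cod T w = SuspO T (Dom T u)"
    and c3: "SuspA T u \<cdot> w = Zero T (Cod T v) (SuspO T (Cod T u))"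
    using C unfolding candidate_triangle_def diagram_def by auto
  have [simp]: "u' \<in> Arr T" "v' \<in> Arr T" "w' \<in> Arr T" "Dom T v' = Cod T u'" "Dom T w' = Cod T v'"
    "Cod T w' = SuspO T (Dom T u')"
    using e by simp_all
  have [simp]: "i\<^sub>1 \<in> Arr T" "Dom T i\<^sub>1 = Dom T u" "Cod T i\<^sub>1 = Dom T u'"
    "i\<^sub>2 \<in> Arr T" "Dom T i\<^sub>2 = Cod T u" "Cod T i\<^sub>2 = Cod T u'"
    "i\<^sub>3 \<in> Arr T" "Dom T i\<^sub>3 = Cod T v" "Cod T i\<^sub>3 = Cod T v'"
    "r\<^sub>1 \<in> Arr T" "Dom T r\<^sub>1 = Dom T u'" "Cod T r\<^sub>1 = Dom T u"
    "r\<^sub>2 \<in> Arr T" "Dom T r\<^sub>2 = Cod T u'" "Cod T r\<^sub>2 = Cod T u"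
    "r\<^sub>3 \<in> Arr T" "Dom T r\<^sub>3 = Cod T v'" "Cod T r\<^sub>3 = Cod T v"
    using i r unfolding diagram_map_def by simp_all
  have i_eq: "i\<^sub>2 \<cdot> u = u' \<cdot> i\<^sub>1" "i\<^sub>3 \<cdot> v = v' \<cdot> i\<^sub>2" "SuspA T i\<^sub>1 \<cdot> w = w' \<cdot> i\<^sub>3"
    and r_eq: "r\<^sub>2 \<cdot> u' = u \<cdot> r\<^sub>1" "r\<^sub>3 \<cdot> v' = v \<cdot> r\<^sub>2" "SuspA T r\<^sub>1 \<cdot> w' = w \<cdot> r\<^sub>3"
    using i r unfolding diagram_map_def by simp_all
  obtain j d where J: "Exact T u j d" using exact_ex[of u "Dom T u" "Cod T u"] by auto
  note f = exactD[OF J]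
  have [simp]: "j \<in> Arr T" "d \<in> Arr T" "Dom T j = Cod T u" "Dom T d = Cod T j"
    "Cod T d = SuspO T (Dom T u)" using f by simp_all
  \<comment> \<open>The filler \<open>k\<close> runs from the cone of \<open>u\<close> into the
    exact triangle. Followed by \<open>r\<^sub>3\<close> it is the comparison arrow, compatible with
    both neighbours because the \<open>r\<close> components undo the \<open>i\<close>
    components.\<close>
  obtain k where "diagram_map T u j d u' v' w' i\<^sub>1 i\<^sub>2 k"
    using exact_fill[OF J E, of i\<^sub>1 i\<^sub>2] i_eq by auto
  then have k [simp]: "k \<in> Arr T" "Dom T k = Cod T j" "Cod T k = Cod T v'"
    and k_eq: "k \<cdot> j = v' \<cdot> i\<^sub>2" "w' \<cdot> k = SuspA T i\<^sub>1 \<cdot> d"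
    unfolding diagram_map_def by simp_all
  have "(r\<^sub>3 \<cdot> k) \<cdot> j = r\<^sub>3 \<cdot> (v' \<cdot> i\<^sub>2)" by (simp add: Comp_assoc k_eq)
  also have "\<dots> = v" using ri by (simp add: Comp_eq_Comp[OF r_eq(2)] Comp_assoc)
  finally have 1: "(r\<^sub>3 \<cdot> k) \<cdot> j = v" .
  have "w \<cdot> (r\<^sub>3 \<cdot> k) = SuspA T r\<^sub>1 \<cdot> (w' \<cdot> k)"
    using Comp_eq_Comp[OF r_eq(3), of k] by (simp add: Comp_assoc)
  also have "\<dots> = SuspA T (r\<^sub>1 \<cdot> i\<^sub>1) \<cdot> d"
    by (simp add: k_eq Comp_assoc)
  also have "\<dots> = d" unfolding ri by simp
  finally have 2: "w \<cdot> (r\<^sub>3 \<cdot> k) = d" .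
  show ?thesis
  proof (rule exact_criterion(2)[OF J _ _ _ _ 1 2])
    show "weak_kernel u v" unfolding weak_kernel_def
    proof (intro ballI impI, elim conjE)
      fix s assume s: "s \<in> Arr T" "Cod T s = Dom T v" "v \<cdot> s = Zero T (Dom T s) (Cod T v)"
      have "v' \<cdot> (i\<^sub>2 \<cdot> s) = i\<^sub>3 \<cdot> (v \<cdot> s)"
        using s(1,2) Comp_eq_Comp[OF i_eq(2), of s] by (simp add: Comp_assoc)
      also have "\<dots> = Zero T (Dom T s) (Cod T v')" using s by simp
      finally obtain x where x: "x \<in> Arr T" "Dom T x = Dom T s" "Cod T x = Dom T u'"
          "u' \<cdot> x = i\<^sub>2 \<cdot> s"
        using weak_kernelE[OF exact_weak_kernel[OF E], of "i\<^sub>2 \<cdot> s"] s by auto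
      have "u \<cdot> (r\<^sub>1 \<cdot> x) = r\<^sub>2 \<cdot> (i\<^sub>2 \<cdot> s)"
        using x Comp_eq_Comp[OF r_eq(1), of x] by (simp add: Comp_assoc)
      also have "\<dots> = s" using s(1,2) by (simp add: Comp_eq_Comp[OF ri(2)])
      finally show "\<exists>r\<in>Arr T. Dom T r = Dom T s \<and> Cod T r = Dom T u \<and> u \<cdot> r = s"
        using x by (intro bexI[of _ "r\<^sub>1 \<cdot> x"]) simp_all
    qed
    show "weak_kernel v w" unfolding weak_kernel_def
    proof (intro ballI impI, elim conjE)
      fix s assume s: "s \<in> Arr T" "Cod T s = Dom T w" "w \<cdot> s = Zero T (Dom T s) (Cod T w)"
      have "w' \<cdot> (i\<^sub>3 \<cdot> s) = SuspA T i\<^sub>1 \<cdot> (w \<cdot> s)"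
        using s(1,2) Comp_eq_Comp[OF i_eq(3), of s] by (simp add: Comp_assoc)
      also have "\<dots> = Zero T (Dom T s) (Cod T w')" using s by simp
      finally obtain x where x: "x \<in> Arr T" "Dom T x = Dom T s" "Cod T x = Dom T v'"
          "v' \<cdot> x = i\<^sub>3 \<cdot> s"
        using weak_kernelE[OF exact_weak_kernel[OF exact_rotateI[OF E]], of "i\<^sub>3 \<cdot> s"] s by auto
      have "v \<cdot> (r\<^sub>2 \<cdot> x) = r\<^sub>3 \<cdot> (i\<^sub>3 \<cdot> s)"
        using x Comp_eq_Comp[OF r_eq(2), of x] by (simp add: Comp_assoc)
      also have "\<dots> = s" using s(1,2) by (simp add: Comp_eq_Comp[OF ri(3)])
      finally show "\<exists>r\<in>Arr T. Dom T r = Dom T s \<and> Cod T r = Dom T v \<and> v \<cdot> r = s"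
        using x by (intro bexI[of _ "r\<^sub>2 \<cdot> x"]) simp_all
    qed
  qed (use c3 in simp_all)
qed

text \<open>The axiom \<open>octahedral\<close> does not state where \<open>f\<close> and \<open>g\<close> begin and end, and composites of
  non-composable arrows are arbitrary.  The type of \<open>i \<cdot> g = SuspA T u \<cdot> m\<close>, where both sides are
  known to be composable, determines the domain of \<open>g\<close>, and then \<open>m \<cdot> f = d\<close> that of \<open>f\<close>.\<close>

lemma octahedralE:
  assumes E1: "Exact T u j d" and E2: "Exact T v k i" and uv: "Cod T u = Dom T v"
    and E3: "Exact T (v \<cdot> u) l m"
  obtains f g where "Exact T f g (SuspA T j \<cdot> i)"
    "f \<in> Arr T" "Dom T f = Cod T j" "Cod T f = Cod T l"
    "g \<in> Arr T" "Dom T g = Cod T l" "Cod T g = Cod T k"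
    "f \<cdot> j = l \<cdot> v" "m \<cdot> f = d" "g \<cdot> l = k" "i \<cdot> g = SuspA T u \<cdot> m"
proof -
  note e1 = exactD(1-6)[OF E1] and e2 = exactD(1-6)[OF E2] and e3 = exactD(1-6)[OF E3]
  obtain f g where E: "Exact T f g (SuspA T j \<cdot> i)"
    and eq: "f \<cdot> j = l \<cdot> v" "m \<cdot> f = d" "g \<cdot> l = k" "i \<cdot> g = SuspA T u \<cdot> m"
    using octahedral[OF E1 E2 uv E3] by blast
  note e = exactD(1-6)[OF E]
  have Cg: "Cod T g = Cod T k" using e e1 e2 uv by simp
  have "Dom T g = Dom T (i \<cdot> g)" using e(2) e2 Cg by simp
  also have "\<dots> = Cod T l" unfolding eq(4) using e1 e2 e3 uv by simp
  finally have Dg: "Dom T g = Cod T l" .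
  have "Dom T f = Dom T (m \<cdot> f)" using e e3 Dg by simp
  also have "\<dots> = Cod T j" unfolding eq(2) using e1 by simp
  finally show ?thesis using that E e Cg Dg eq by auto
qed

end

section \<open>Maps of triangles that are the identity on the first object\<close>

locale identity_triangle_map = triangulated_category +
  fixes X Y Z Y' Z' u v w u' v' w' g h
  assumes u: "u \<in> Hom T X Y" and v: "v \<in> Hom T Y Z" and w: "w \<in> Hom T Z (SuspO T X)"
    and u': "u' \<in> Hom T X Y'" and v': "v' \<in> Hom T Y' Z'" and w': "w' \<in> Hom T Z' (SuspO T X)"
    and g: "g \<in> Hom T Y Y'" and h: "h \<in> Hom T Z Z'"
    and triangle_map: "triangle_map T u v w u' v' w' (Id T X) g h"
begin

section \<open>Types and commutation relations of the given map\<close>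

lemma arrows [simp]:
  "u \<in> Arr T" "Dom T u = X" "Cod T u = Y" "v \<in> Arr T" "Dom T v = Y" "Cod T v = Z"
  "w \<in> Arr T" "Dom T w = Z" "Cod T w = SuspO T X"
  "u' \<in> Arr T" "Dom T u' = X" "Cod T u' = Y'" "v' \<in> Arr T" "Dom T v' = Y'" "Cod T v' = Z'"
  "w' \<in> Arr T" "Dom T w' = Z'" "Cod T w' = SuspO T X"
  "g \<in> Arr T" "Dom T g = Y" "Cod T g = Y'" "h \<in> Arr T" "Dom T h = Z" "Cod T h = Z'"
  using u v w u' v' w' g h by simp_all

lemma objects [simp]: "X \<in> Obj T" "Y \<in> Obj T" "Z \<in> Obj T" "Y' \<in> Obj T" "Z' \<in> Obj T"
  using dom_obj[of u] dom_obj[of v] dom_obj[of w] dom_obj[of v'] dom_obj[of w'] by simp_all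

lemma top: "Exact T u v w" and bottom: "Exact T u' v' w'"
  using triangle_map unfolding triangle_map_def by blast+

lemma squares: "g \<cdot> u = u'" "h \<cdot> v = v' \<cdot> g" "w' \<cdot> h = w"
  using triangle_map unfolding triangle_map_def diagram_map_def by simp_all

lemma zeros [simp]: "v \<cdot> u = Zero T X Z" "w \<cdot> v = Zero T Y (SuspO T X)"
  "SuspA T u \<cdot> w = Zero T Z (SuspO T Y)" "v' \<cdot> u' = Zero T X Z'" "w' \<cdot> v' = Zero T Y' (SuspO T X)"
  "SuspA T u' \<cdot> w' = Zero T Z' (SuspO T Y')"
  using exactD(7-9)[OF top] exactD(7-9)[OF bottom] by simp_all

lemmas squares_Comp = squares[THEN Comp_eq_Comp]
lemmas zeros_Comp = zeros[THEN Comp_eq_Zero]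

lemma SuspA_squares: "SuspA T g \<cdot> SuspA T u = SuspA T u'"
  "SuspA T v \<cdot> SuspA T u = Zero T (SuspO T X) (SuspO T Z)"
  by (simp_all add: squares flip: SuspA_Comp)

section \<open>The candidate triangle of the middle square\<close>

abbreviation a where "a \<equiv> Col T g v"
abbreviation b where "b \<equiv> Row T v' (Neg T h)"
abbreviation c where "c \<equiv> SuspA T u \<cdot> w'"

text \<open>The composite at \<open>Z'\<close> vanishes since \<open>w' \<cdot> v' = 0\<close>,
  \<open>w' \<cdot> h = w\<close> and \<open>SuspA T u \<cdot> w = 0\<close>; the one at
  \<open>SuspO T Y\<close> since \<open>g \<cdot> u = u'\<close>,
  \<open>SuspA T u' \<cdot> w' = 0\<close> and \<open>v \<cdot> u = 0\<close>.\<close>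

lemma square_candidate: "candidate_triangle T a b c"
proof (rule candidate_triangleI)
  show "SuspA T a \<cdot> c = Zero T (Cod T b) (SuspO T (Cod T a))"
    by (simp add: Col_def Comp_assoc Comp_eq_Comp[OF SuspA_squares(1)]
        Comp_eq_Zero[OF SuspA_squares(2)])
  show "c \<cdot> b = Zero T (Cod T a) (SuspO T (Dom T a))"
    by (simp add: Row_def Comp_assoc squares zeros_Comp squares_Comp)
qed (simp_all add: Row_Col squares)

section \<open>The mapping cone, and the square as a retract of it\<close>

abbreviation \<alpha> where "\<alpha> \<equiv> Mat T u' g (Zero T X Z) (Neg T v)"
abbreviation \<beta> where "\<beta> \<equiv> Mat T v' h (Zero T Y' (SuspO T X)) (Neg T w)"
text \<open>The suspension of \<open>Id T X\<close> from the general cone is already replaced by the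
  identity of \<open>SuspO T X\<close>.\<close>

abbreviation \<gamma> where "\<gamma> \<equiv> susp_dsum T X Y \<cdot>
  Mat T w' (Id T (SuspO T X)) (Zero T Z' (SuspO T Y)) (Neg T (SuspA T u))"

lemma good_iff: "good T u v w u' v' w' (Id T X) g h \<longleftrightarrow> Exact T \<alpha> \<beta> \<gamma>"
  unfolding good_def using triangle_map by simp

lemma cone_eq:
  "\<alpha> = Inj1 T Y' Z \<cdot> (u' \<cdot> Proj1 T X Y) \<boxplus> (Inj1 T Y' Z \<cdot> (g \<cdot> Proj2 T X Y)
     \<boxplus> Neg T (Inj2 T Y' Z \<cdot> (v \<cdot> Proj2 T X Y)))"
  "\<beta> = Inj1 T Z' (SuspO T X) \<cdot> (v' \<cdot> Proj1 T Y' Z) \<boxplus> (Inj1 T Z' (SuspO T X) \<cdot> (h \<cdot> Proj2 T Y' Z)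
     \<boxplus> Neg T (Inj2 T Z' (SuspO T X) \<cdot> (w \<cdot> Proj2 T Y' Z)))"
  "\<gamma> = SuspA T (Inj1 T X Y) \<cdot> (w' \<cdot> Proj1 T Z' (SuspO T X))
     \<boxplus> (SuspA T (Inj1 T X Y) \<cdot> Proj2 T Z' (SuspO T X)
     \<boxplus> Neg T (SuspA T (Inj2 T X Y) \<cdot> (SuspA T u \<cdot> Proj2 T Z' (SuspO T X))))"
  by (simp_all add: Mat_def susp_dsum_def Row_def Col_def Comp_assoc)

lemma cone_arrows [simp]:
  "\<alpha> \<in> Arr T" "Dom T \<alpha> = Dsum T X Y" "Cod T \<alpha> = Dsum T Y' Z"
  "\<beta> \<in> Arr T" "Dom T \<beta> = Dsum T Y' Z" "Cod T \<beta> = Dsum T Z' (SuspO T X)"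
  "\<gamma> \<in> Arr T" "Dom T \<gamma> = Dsum T Z' (SuspO T X)" "Cod T \<gamma> = SuspO T (Dsum T X Y)"
  by (simp_all add: cone_eq)

abbreviation i1 where "i1 \<equiv> Inj2 T X Y"
abbreviation i2 where "i2 \<equiv> Row T (Inj1 T Y' Z) (Neg T (Inj2 T Y' Z))"
abbreviation i3 where "i3 \<equiv> Col T (Id T Z') (Neg T w')"
abbreviation r1 where "r1 \<equiv> Row T u (Id T Y)"
abbreviation r3 where "r3 \<equiv> Proj1 T Z' (SuspO T X)"

text \<open>The sign matrix reconciles \<open>v\<close>, \<open>- h\<close> in the square with
  \<open>- v\<close>, \<open>h\<close> in the cone. Being its own inverse, it is the middle
  component of both the inclusion and the projection.\<close>

lemma i2_i2: "i2 \<cdot> i2 = Id T (Dsum T Y' Z)"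
  by (rule dsum_eqI_inj[of Y' Z]) (simp_all add: Row_def Comp_assoc)

lemma to_cone: "diagram_map T a b c \<alpha> \<beta> \<gamma> i1 i2 i3"
proof -
  have "i2 \<cdot> a = \<alpha> \<cdot> i1"
    by (simp add: cone_eq Row_def Col_def Comp_assoc)
  \<comment> \<open>In the lower row \<open>- w' \<cdot> v'\<close> vanishes and
    \<open>w' \<cdot> h = w\<close>; this is why \<open>i3\<close> has the entry
    \<open>- w'\<close>.\<close>
  moreover have "i3 \<cdot> b = \<beta> \<cdot> i2"
    by (rule dsum_eqI_inj[of Y' Z])
      (simp_all add: cone_eq Row_def Col_def Comp_assoc squares zeros_Comp squares_Comp)
  moreover have "SuspA T i1 \<cdot> c = \<gamma> \<cdot> i3"
    by (simp add: cone_eq Row_def Col_def Comp_assoc)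
  ultimately show ?thesis unfolding diagram_map_def by simp
qed

lemma from_cone: "diagram_map T \<alpha> \<beta> \<gamma> a b c r1 i2 r3"
proof -
  have "i2 \<cdot> \<alpha> = a \<cdot> r1"
    by (rule dsum_eqI_inj[of X Y])
      (simp_all add: cone_eq Row_def Col_def Comp_assoc squares zeros_Comp squares_Comp)
  moreover have "r3 \<cdot> \<beta> = b \<cdot> i2"
    by (rule dsum_eqI_inj[of Y' Z]) (simp_all add: cone_eq Row_def Comp_assoc)
  moreover have "SuspA T r1 \<cdot> \<gamma> = c \<cdot> r3"
  proof -
    \<comment> \<open>\<open>\<gamma>\<close> ends in the suspension of a direct sum, so
      \<open>SuspA T r1\<close> is evaluated on the suspended injections.\<close>
    have "SuspA T r1 \<cdot> SuspA T (Inj1 T X Y) = SuspA T u"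
      "SuspA T r1 \<cdot> SuspA T (Inj2 T X Y) = Id T (SuspO T Y)"
      by (simp_all add: Row_inj del: SuspA_Comp flip: SuspA_Comp)
    from this[THEN Comp_eq_Comp] show ?thesis
      by (simp add: cone_eq Comp_assoc)
  qed
  ultimately show ?thesis unfolding diagram_map_def by simp
qed

section \<open>Exactness of the cone against exactness of \<open>(\<ast>)\<close>\<close>

lemma square_of_cone:
  assumes "Exact T \<alpha> \<beta> \<gamma>"
  shows "Exact T a b c"
proof (rule exact_retract[OF assms square_candidate to_cone from_cone])
  show "r3 \<cdot> i3 = Id T (Dom T c)" by (simp add: Col_def)
qed (simp_all add: Row_inj i2_i2)

lemma cone_of_square:
  assumes E: "Exact T a b c"
  shows "Exact T \<alpha> \<beta> \<gamma>"
proof -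
  have to: "i2 \<cdot> a = \<alpha> \<cdot> i1" "i3 \<cdot> b = \<beta> \<cdot> i2" "SuspA T i1 \<cdot> c = \<gamma> \<cdot> i3"
    using to_cone unfolding diagram_map_def by simp_all
  have fc: "i2 \<cdot> \<alpha> = a \<cdot> r1" "r3 \<cdot> \<beta> = b \<cdot> i2" "SuspA T r1 \<cdot> \<gamma> = c \<cdot> r3"
    using from_cone unfolding diagram_map_def by simp_all
  obtain j d where J: "Exact T \<alpha> j d" using exact_ex[of \<alpha> "Dsum T X Y" "Dsum T Y' Z"] by auto
  note f = exactD[OF J]
  have [simp]: "j \<in> Arr T" "d \<in> Arr T" "Dom T j = Dsum T Y' Z" "Dom T d = Cod T j"
    "Cod T d = SuspO T (Dsum T X Y)" using f by simp_all
  have dj: "d \<cdot> j = Zero T (Dsum T Y' Z) (SuspO T (Dsum T X Y))" using f(8) by simp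
  obtain k where "diagram_map T \<alpha> j d a b c r1 i2 k"
    using exact_fill[OF J E, of r1 i2] fc by auto
  then have k [simp]: "k \<in> Arr T" "Dom T k = Cod T j" "Cod T k = Z'"
    and k_eq: "k \<cdot> j = b \<cdot> i2" "c \<cdot> k = SuspA T r1 \<cdot> d"
    unfolding diagram_map_def by simp_all
  \<comment> \<open>The comparison from the cone of \<open>\<alpha>\<close> has two parts:
    \<open>k\<close>, which lands in \<open>(\<ast>)\<close> and is included by \<open>i3\<close>,
    and the \<Sigma>X component of the connecting arrow \<open>d\<close>, which accounts for the
    contractible summand.\<close>
  define \<phi> where "\<phi> = i3 \<cdot> k \<boxplus> Inj2 T Z' (SuspO T X) \<cdot> (SuspA T (Proj1 T X Y) \<cdot> d)"
  have \<phi> [simp]: "\<phi> \<in> Arr T" "Dom T \<phi> = Cod T j" "Cod T \<phi> = Dsum T Z' (SuspO T X)"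
    unfolding \<phi>_def by simp_all
  have "\<phi> \<cdot> j = i3 \<cdot> (k \<cdot> j)"
    unfolding \<phi>_def by (simp add: Comp_assoc dj)
  also have "\<dots> = \<beta> \<cdot> (i2 \<cdot> i2)"
    unfolding k_eq using Comp_eq_Comp[OF to(2), of i2] by (simp add: Comp_assoc)
  also have "\<dots> = \<beta>" unfolding i2_i2 by simp
  finally have 1: "\<phi> \<cdot> j = \<beta>" .
  \<comment> \<open>The identity of the sum splits into the idempotent of the summand from
    \<open>(\<ast>)\<close> and the one onto the graph of \<open>- u\<close>, a copy of
    \<open>X\<close>. The two terms of \<open>\<gamma> \<cdot> \<phi>\<close> are the suspensions of
    these followed by \<open>d\<close>.\<close>
  have split: "i1 \<cdot> r1 \<boxplus> (Inj1 T X Y \<boxplus> Neg T (Inj2 T X Y \<cdot> u)) \<cdot> Proj1 T X Y = Id T (Dsum T X Y)"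
    by (rule dsum_eqI_inj[of X Y]) (simp_all add: Row_inj Row_def Comp_assoc Add_ac)
  have "\<gamma> \<cdot> (i3 \<cdot> k) = SuspA T i1 \<cdot> (c \<cdot> k)"
    using Comp_eq_Comp[OF to(3), of k] by (simp add: Comp_assoc)
  also have "\<dots> = SuspA T (i1 \<cdot> r1) \<cdot> d"
    unfolding k_eq by (simp add: Comp_assoc)
  finally have "\<gamma> \<cdot> (i3 \<cdot> k) = SuspA T (i1 \<cdot> r1) \<cdot> d" .
  moreover have "\<gamma> \<cdot> (Inj2 T Z' (SuspO T X) \<cdot> (SuspA T (Proj1 T X Y) \<cdot> d)) =
      SuspA T ((Inj1 T X Y \<boxplus> Neg T (Inj2 T X Y \<cdot> u)) \<cdot> Proj1 T X Y) \<cdot> d"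
    by (simp add: cone_eq Comp_assoc)
  ultimately have "\<gamma> \<cdot> \<phi> = SuspA T (i1 \<cdot> r1 \<boxplus> (Inj1 T X Y \<boxplus> Neg T (Inj2 T X Y \<cdot> u)) \<cdot> Proj1 T X Y) \<cdot> d"
    unfolding \<phi>_def
    by (subst SuspA_Add) (simp_all del: SuspA_Comp)
  then have 2: "\<gamma> \<cdot> \<phi> = d" unfolding split by simp
  show ?thesis
  proof (rule exact_criterion(2)[OF J _ _ _ _ 1 2])
    show "weak_kernel \<alpha> \<beta>" unfolding weak_kernel_def
    proof (intro ballI impI, elim conjE)
      fix s assume s: "s \<in> Arr T" "Cod T s = Dom T \<beta>" "\<beta> \<cdot> s = Zero T (Dom T s) (Cod T \<beta>)"
      \<comment> \<open>Factoring in \<open>(\<ast>)\<close> and including the result recovers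
        \<open>s\<close> itself, because \<open>i2\<close> is invertible.\<close>
      have "b \<cdot> (i2 \<cdot> s) = r3 \<cdot> (\<beta> \<cdot> s)"
        using s(1,2) Comp_eq_Comp[OF fc(2), of s] by (simp add: Comp_assoc)
      also have "\<dots> = Zero T (Dom T s) Z'" unfolding s(3) using s(1) by simp
      finally obtain x where x: "x \<in> Arr T" "Dom T x = Dom T s" "Cod T x = Y" "a \<cdot> x = i2 \<cdot> s"
        using weak_kernelE[OF exact_weak_kernel[OF E], of "i2 \<cdot> s"] s(1,2) by auto
      have "\<alpha> \<cdot> (i1 \<cdot> x) = i2 \<cdot> (a \<cdot> x)"
        using x(1-3) Comp_eq_Comp[OF to(1), of x] by (simp add: Comp_assoc)
      also have "\<dots> = s" unfolding x(4) using s(1,2) by (simp add: Comp_eq_Comp[OF i2_i2])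
      finally show "\<exists>r\<in>Arr T. Dom T r = Dom T s \<and> Cod T r = Dom T \<alpha> \<and> \<alpha> \<cdot> r = s"
        using x by (intro bexI[of _ "i1 \<cdot> x"]) simp_all
    qed
    show "weak_kernel \<beta> \<gamma>" unfolding weak_kernel_def
    proof (intro ballI impI, elim conjE)
      fix s assume s: "s \<in> Arr T" "Cod T s = Dom T \<gamma>" "\<gamma> \<cdot> s = Zero T (Dom T s) (Cod T \<gamma>)"
      have "c \<cdot> (r3 \<cdot> s) = SuspA T r1 \<cdot> (\<gamma> \<cdot> s)"
        using s(1,2) Comp_eq_Comp[OF fc(3), of s] by (simp add: Comp_assoc)
      also have "\<dots> = Zero T (Dom T s) (SuspO T Y)" unfolding s(3) using s(1) by simp
      finally obtain x where x: "x \<in> Arr T" "Dom T x = Dom T s" "Cod T x = Dsum T Y' Z"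
          "b \<cdot> x = r3 \<cdot> s"
        using weak_kernelE[OF exact_weak_kernel[OF exact_rotateI[OF E]], of "r3 \<cdot> s"] s(1,2) by auto
      have P1: "SuspA T (Proj1 T X Y) \<cdot> SuspA T (Inj1 T X Y) = Id T (SuspO T X)"
        "SuspA T (Proj1 T X Y) \<cdot> SuspA T (Inj2 T X Y) = Zero T (SuspO T Y) (SuspO T X)"
        by (simp_all flip: SuspA_Comp)
      \<comment> \<open>The \<Sigma>X component of \<open>\<gamma> \<cdot> s = 0\<close> makes the
        second coordinate of \<open>s\<close> equal to \<open>- w'\<close> applied to the first.
        Hence \<open>s\<close> factors through \<open>i3\<close>, and a factorisation in
        \<open>(\<ast>)\<close> suffices.\<close>
      have "w' \<cdot> (r3 \<cdot> s) \<boxplus> Proj2 T Z' (SuspO T X) \<cdot> s = SuspA T (Proj1 T X Y) \<cdot> (\<gamma> \<cdot> s)"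
        using s(1,2) by (simp add: cone_eq Comp_assoc Comp_eq_Comp[OF P1(1)] Comp_eq_Zero[OF P1(2)])
      also have "\<dots> = Zero T (Dom T s) (SuspO T X)" unfolding s(3) using s(1) by simp
      finally have "Proj2 T Z' (SuspO T X) \<cdot> s = Neg T (w' \<cdot> (r3 \<cdot> s))"
        using s(1,2) by (intro Neg_unique) simp_all
      then have "i3 \<cdot> (r3 \<cdot> s) = s"
        using inj_proj_Comp[of Z' "SuspO T X" s] s(1,2) by (simp add: Col_def Comp_assoc)
      moreover have "\<beta> \<cdot> (i2 \<cdot> x) = i3 \<cdot> (b \<cdot> x)"
        using x(1-3) Comp_eq_Comp[OF to(2), of x] by (simp add: Comp_assoc)
      ultimately have "\<beta> \<cdot> (i2 \<cdot> x) = s" unfolding x(4) by simp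
      then show "\<exists>r\<in>Arr T. Dom T r = Dom T s \<and> Cod T r = Dom T \<beta> \<and> \<beta> \<cdot> r = s"
        using x by (intro bexI[of _ "i2 \<cdot> x"]) simp_all
    qed
    \<comment> \<open>Every term of \<open>\<gamma>\<close> begins on the left with a suspended
      injection, so only the suspended columns of \<open>\<alpha>\<close> are needed.\<close>
    have S: "SuspA T (\<alpha> \<cdot> Inj1 T X Y) = SuspA T (Inj1 T Y' Z) \<cdot> SuspA T u'"
      "SuspA T (\<alpha> \<cdot> Inj2 T X Y) = SuspA T (Inj1 T Y' Z) \<cdot> SuspA T g
        \<boxplus> Neg T (SuspA T (Inj2 T Y' Z) \<cdot> SuspA T v)"
      by (simp_all add: cone_eq Comp_assoc)
    have S': "SuspA T \<alpha> \<cdot> SuspA T (Inj1 T X Y) = SuspA T (Inj1 T Y' Z) \<cdot> SuspA T u'"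
      "SuspA T \<alpha> \<cdot> SuspA T (Inj2 T X Y) = SuspA T (Inj1 T Y' Z) \<cdot> SuspA T g
        \<boxplus> Neg T (SuspA T (Inj2 T Y' Z) \<cdot> SuspA T v)"
      unfolding S[symmetric] by simp_all
    have SA: "SuspA T \<alpha> \<in> Arr T" "Dom T (SuspA T \<alpha>) = SuspO T (Dsum T X Y)"
       "Cod T (SuspA T \<alpha>) = SuspO T (Dsum T Y' Z)" by simp_all
    show "SuspA T \<alpha> \<cdot> \<gamma> = Zero T (Dom T \<gamma>) (SuspO T (Cod T \<alpha>))"
      unfolding cone_eq(3) using SA S'[THEN Comp_eq_Comp]
      by (simp add: Comp_assoc Comp_eq_Comp[OF SuspA_squares(1)]
          Comp_eq_Zero[OF SuspA_squares(2)] zeros_Comp)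
  qed simp_all
qed

section \<open>Replacing the first and the second map of \<open>(\<ast>)\<close>\<close>

lemma first_replaceable: "\<exists>a\<^sub>1 \<in> Hom T Y (Dsum T Y' Z). Exact T a\<^sub>1 b c"
proof -
  obtain d e where E: "Exact T b d e" using exact_ex[of b "Dsum T Y' Z" Z'] by auto
  have [simp]: "d \<in> Arr T" "e \<in> Arr T" "Dom T d = Z'" "Dom T e = Cod T d"
    "Cod T e = SuspO T (Dsum T Y' Z)" using exactD(1-6)[OF E] by simp_all
  have b: "b \<cdot> Inj1 T Y' Z = v'" "b \<cdot> Inj2 T Y' Z = Neg T h"
    by (simp_all add: Row_inj)
  have "Exact T (b \<cdot> Inj1 T Y' Z) w' (Neg T (SuspA T u'))"
    unfolding b using exact_rotateI[OF bottom] .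
  note E3 = this
  \<comment> \<open>In the octahedron on \<open>v' = b \<cdot> Inj1 T Y' Z\<close> the three cones
    are \<open>Z\<close>, the unknown cone of \<open>b\<close>, and \<Sigma>X.\<close>
  obtain f k where F: "Exact T f k (SuspA T (Proj2 T Y' Z) \<cdot> e)"
    and fk: "f \<in> Arr T" "Dom T f = Cod T (Proj2 T Y' Z)" "Cod T f = Cod T w'"
      "k \<in> Arr T" "Dom T k = Cod T w'" "Cod T k = Cod T d"
    and f: "f \<cdot> Proj2 T Y' Z = w' \<cdot> b" and k: "k \<cdot> w' = d"
    by (rule octahedralE[OF exact_split[of Y' Z] E _ E3]) simp_all
  have [simp]: "f \<in> Arr T" "Dom T f = Z" "Cod T f = SuspO T X"
      "k \<in> Arr T" "Dom T k = SuspO T X" "Cod T k = Cod T d"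
    using fk by simp_all
  \<comment> \<open>The octahedron determines \<open>f\<close> only after \<open>Proj2\<close>;
    precomposing with the section \<open>Inj2\<close> gives \<open>f = - w\<close>.\<close>
  have "f = (f \<cdot> Proj2 T Y' Z) \<cdot> Inj2 T Y' Z" by (simp add: Comp_assoc)
  also have "\<dots> = w' \<cdot> (b \<cdot> Inj2 T Y' Z)" unfolding f by (simp add: Comp_assoc)
  also have "\<dots> = Neg T w" unfolding b by (simp add: squares)
  finally have "Exact T (Neg T w) k (SuspA T (Proj2 T Y' Z) \<cdot> e)" using F by simp
  \<comment> \<open>The top triangle, rotated twice with signs cleared, is a second triangle on
    \<open>- w\<close>. So the cone of \<open>b\<close> is \<Sigma>Y with \<open>k\<close>
    corresponding to \<open>SuspA T u\<close>, and \<open>d = k \<cdot> w'\<close> becomes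
    \<open>c\<close>.\<close>
  moreover have "Exact T (Neg T w) (SuspA T u) (Neg T (SuspA T v))"
    using exact_Neg_Neg[OF exact_rotateI[OF exact_rotateI[OF top]]] by simp
  ultimately obtain \<theta> where \<theta>: "iso_arrow T \<theta>" "Dom T \<theta> = Cod T d" "Cod T \<theta> = SuspO T Y"
    "\<theta> \<cdot> k = SuspA T u"
    using exact_comparison[of "Neg T w" k _ "SuspA T u"]
    by (metis SuspA_arrow(3) \<open>Cod T k = Cod T d\<close> arrows(1,3))
  obtain \<theta>' where \<theta>': "\<theta> \<in> Arr T" "\<theta>' \<in> Arr T" "Dom T \<theta>' = Cod T \<theta>" "Cod T \<theta>' = Dom T \<theta>"
    "\<theta>' \<cdot> \<theta> = Id T (Dom T \<theta>)" "\<theta> \<cdot> \<theta>' = Id T (Cod T \<theta>)"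
    using \<theta>(1) by (rule iso_arrowE)
  have "\<theta> \<cdot> d = c" unfolding k[symmetric] using \<theta> \<theta>' by (simp add: Comp_eq_Comp[OF \<theta>(4)])
  then have Ec: "Exact T b c (e \<cdot> \<theta>')"
    using exact_change_third[OF E \<theta>'(1) \<theta>(2) \<theta>'(2-)] by simp
  \<comment> \<open>Rotation puts a minus sign on the suspended arrow, so the negated third arrow is
    desuspended.\<close>
  obtain a\<^sub>1 where a1: "a\<^sub>1 \<in> Arr T" "Dom T a\<^sub>1 = Y" "Cod T a\<^sub>1 = Dsum T Y' Z"
    "SuspA T a\<^sub>1 = Neg T (e \<cdot> \<theta>')"
    using SuspA_full[of Y "Dsum T Y' Z" "Neg T (e \<cdot> \<theta>')"] \<theta> \<theta>' by auto
  have "Exact T b c (Neg T (SuspA T a\<^sub>1))" using Ec a1 \<theta> \<theta>' by simp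
  then have "Exact T a\<^sub>1 b c" by (rule exact_unrotate) (use a1 in simp_all)
  then show ?thesis using a1 by auto
qed

lemma second_replaceable: "\<exists>b\<^sub>1 \<in> Hom T (Dsum T Y' Z) Z'. Exact T a b\<^sub>1 c"
proof -
  obtain j d where E: "Exact T a j d" using exact_ex[of a Y "Dsum T Y' Z"] by auto
  have [simp]: "j \<in> Arr T" "d \<in> Arr T" "Dom T j = Dsum T Y' Z" "Dom T d = Cod T j"
    "Cod T d = SuspO T Y" using exactD(1-6)[OF E] by simp_all
  have a: "Proj1 T Y' Z \<cdot> a = g" "Proj2 T Y' Z \<cdot> a = v"
    by (simp_all add: Col_def)
  have "Exact T (Proj2 T Y' Z \<cdot> a) w (Neg T (SuspA T u))"
    unfolding a using exact_rotateI[OF top] .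
  note E3 = this
  \<comment> \<open>In the octahedron on \<open>v = Proj2 T Y' Z \<cdot> a\<close> the cones are the
    unknown cone of \<open>a\<close>, \<Sigma>Y' from the rotated split triangle, and
    \<Sigma>X.\<close>
  obtain f k where F: "Exact T f k (SuspA T j \<cdot> Neg T (SuspA T (Inj1 T Y' Z)))"
    and fk: "f \<in> Arr T" "Dom T f = Cod T j" "Cod T f = Cod T w"
      "k \<in> Arr T" "Dom T k = Cod T w" "Cod T k = Cod T (Zero T Z (SuspO T Y'))"
    and f: "Neg T (SuspA T u) \<cdot> f = d"
    and k: "Neg T (SuspA T (Inj1 T Y' Z)) \<cdot> k = SuspA T a \<cdot> Neg T (SuspA T u)"
    by (rule octahedralE[OF E exact_rotateI[OF exact_split[of Y' Z]] _ E3]) simp_all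
  have [simp]: "f \<in> Arr T" "Dom T f = Cod T j" "Cod T f = SuspO T X"
      "k \<in> Arr T" "Dom T k = SuspO T X" "Cod T k = SuspO T Y'"
    using fk by simp_all
  have P: "SuspA T (Proj1 T Y' Z) \<cdot> SuspA T (Inj1 T Y' Z) = Id T (SuspO T Y')"
    "SuspA T (Proj1 T Y' Z) \<cdot> SuspA T a = SuspA T g"
    by (simp_all add: a flip: SuspA_Comp)
  \<comment> \<open>The suspended injection in the last octahedral relation is cancelled by
    projecting to \<Sigma>Y'; this leaves \<open>g \<cdot> u = u'\<close>.\<close>
  have "Neg T k = SuspA T (Proj1 T Y' Z) \<cdot> (Neg T (SuspA T (Inj1 T Y' Z)) \<cdot> k)"
    by (simp add: Comp_eq_Comp[OF P(1)])
  also have "\<dots> = Neg T (SuspA T u')"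
    unfolding k by (simp add: Comp_eq_Comp[OF P(2)] SuspA_squares)
  finally have "k = SuspA T u'" by (metis Neg_Neg SuspA_arrow(1) \<open>k \<in> Arr T\<close> arrows(10))
  \<comment> \<open>With both signs changed, this has the shape of a twice rotated triangle on
    \<open>u'\<close>, so the cone of \<open>a\<close> is also a cone of \<open>u'\<close> and can
    be compared with \<open>Z'\<close>.\<close>
  then have "Exact T (Neg T f) (Neg T (SuspA T u')) (Neg T (SuspA T (j \<cdot> Inj1 T Y' Z)))"
    using exact_Neg_Neg[OF F] by simp
  then have "Exact T (j \<cdot> Inj1 T Y' Z) (Neg T f) (Neg T (SuspA T u'))"
    by (rule exact_unrotate) simp_all
  then have "Exact T u' (j \<cdot> Inj1 T Y' Z) (Neg T f)"
    by (rule exact_unrotate) simp_all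
  then obtain \<theta> where \<theta>: "iso_arrow T \<theta>" "Dom T \<theta> = Cod T j" "Cod T \<theta> = Z'" "w' \<cdot> \<theta> = Neg T f"
    using exact_comparison[OF _ bottom]
    by (metis Comp_arrow(3) \<open>j \<in> Arr T\<close> arrows(15)
        dsum_arrows(2,4) objects(3,4) \<open>Dom T j = Dsum T Y' Z\<close>)
  obtain \<theta>' where \<theta>': "\<theta> \<in> Arr T" "\<theta>' \<in> Arr T" "Dom T \<theta>' = Cod T \<theta>" "Cod T \<theta>' = Dom T \<theta>"
    "\<theta>' \<cdot> \<theta> = Id T (Dom T \<theta>)" "\<theta> \<cdot> \<theta>' = Id T (Cod T \<theta>)"
    using \<theta>(1) by (rule iso_arrowE)
  \<comment> \<open>The sign here cancels the one in \<open>d = - SuspA T u \<cdot> f\<close>, so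
    the differential becomes \<open>c\<close> exactly, not merely up to sign.\<close>
  have "f = Neg T (w' \<cdot> \<theta>)" using \<theta> by simp
  then have "f \<cdot> \<theta>' = Neg T w'" using \<theta>(2,3) \<theta>' by (simp add: Comp_assoc)
  then have "d \<cdot> \<theta>' = c" unfolding f[symmetric] using \<theta>(2,3) \<theta>' by (simp add: Comp_assoc)
  then have "Exact T a (\<theta> \<cdot> j) c"
    using exact_change_third[OF E \<theta>'(1) \<theta>(2) \<theta>'(2-)] by simp
  then show ?thesis using \<theta>(2,3) \<theta>' by (intro bexI[of _ "\<theta> \<cdot> j"]) simp_all
qed

section \<open>The two equivalences\<close>

lemma homotopy_cartesian_with_iff:
  "homotopy_cartesian_with T v g h v' d \<longleftrightarrow> d \<in> Hom T Z' (SuspO T Y) \<and> Exact T a b d"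
  unfolding homotopy_cartesian_with_def using squares by auto

lemma good_and_replaceable_iff:
  "candidate_triangle T a b c \<and>
    (good T u v w u' v' w' (Id T X) g h \<longleftrightarrow> homotopy_cartesian_with T v g h v' c) \<and>
    (homotopy_cartesian T v g h v' \<longleftrightarrow> replaceably_exact T a b c)"
proof (intro conjI)
  show "candidate_triangle T a b c" by (rule square_candidate)
  show "good T u v w u' v' w' (Id T X) g h \<longleftrightarrow> homotopy_cartesian_with T v g h v' c"
    unfolding good_iff homotopy_cartesian_with_iff using square_of_cone cone_of_square by auto
  \<comment> \<open>A differential for the square is the same thing as a replacement of the third
    map; the other two replacements exist in any case.\<close>
  show "homotopy_cartesian T v g h v' \<longleftrightarrow> replaceably_exact T a b c"
    unfolding homotopy_cartesian_def homotopy_cartesian_with_iff replaceably_exact_def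
    using square_candidate first_replaceable second_replaceable by auto
qed

end

theorem proposition6p9:
  fixes T :: "('o, 'm, 'r) triangulated_category_scheme" (structure)
    and X Y Z Y' Z' :: 'o
    and u v w u' v' w' g h :: 'm
  assumes "triangulated_category T"
    and "u \<in> Hom T X Y" and "v \<in> Hom T Y Z" and "w \<in> Hom T Z (SuspO T X)"
    and "u' \<in> Hom T X Y'" and "v' \<in> Hom T Y' Z'" and "w' \<in> Hom T Z' (SuspO T X)"
    and "g \<in> Hom T Y Y'" and "h \<in> Hom T Z Z'"
    and "triangle_map T u v w u' v' w' (Id T X) g h"
  shows "candidate_triangle T (Col T g v) (Row T v' (Neg T h)) (SuspA T u \<cdot> w') \<and>
    (good T u v w u' v' w' (Id T X) g h \<longleftrightarrow>
       homotopy_cartesian_with T v g h v' (SuspA T u \<cdot> w')) \<and>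
    (homotopy_cartesian T v g h v' \<longleftrightarrow>
       replaceably_exact T (Col T g v) (Row T v' (Neg T h)) (SuspA T u \<cdot> w'))"
proof -
  interpret triangulated_category T by fact
  interpret identity_triangle_map T X Y Z Y' Z' u v w u' v' w' g h
    by unfold_locales fact+
  show ?thesis by (rule good_and_replaceable_iff)
qed

end
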